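(* Let $n\ge1$, and if $\operatorname{char}(K)=p>0$ assume $n\le p-1$. Then $|f|_n=|f|_{C^n}$ for every $f\in C^n(R,K)$, where $|f|_{C^n}=\max_{0\le j\le n}\sup_{x\in R^{j+1}}|\Phi_jf(x)|$ (with $\Phi_jf$ denoting its continuous extension to $R^{j+1}$).
   Context: $K$ is a local field: the fraction field of a complete discrete valuation ring $R$ with finite residue field $\kappa$ of cardinality $q$. Fix a uniformizer $\pi$, normalize $|\pi|=q^{-1}$, and fix a set $\mathcal{T}\subset R$ of representatives of $\kappa$ containing $0$; every $x\in R$ has a unique expansion $x=\sum_{i\ge0}a_i\pi^i$, $a_i\in\mathcal{T}$. Let $\mathcal{R}_m=\{\sum_{i=0}^{m-1}a_i\pi^i: a_i\in\mathcal{T}\}$ ($m\ge1$), $\mathcal{R}_+=\bigcup_{m\ge1}\mathcal{R}_m$. For $r\in\mathcal{R}_+$ written $r=\sum_{i=0}^{m}a_i\pi^i$ with $a_i\in\mathcal{T}$, $a_m\neq0$, put $r_-=\sum_{i=0}^{m-1}a_i\pi^i$. Difference quotients: $\nabla^kR=\{(x_1,\dots,x_k)\in R^k: x_i\ne x_j\text{ for }i\neq j\}$; for $f:R\to K$, $\Phi_0f=f$ and $\Phi_kf(x_1,\dots,x_{k+1})=\frac{\Phi_{k-1}f(x_1,x_3,\dots,x_{k+1})-\Phi_{k-1}f(x_2,x_3,\dots,x_{k+1})}{x_1-x_2}$ on $\nabla^{k+1}R$. $f$ is $C^k$ if $\Phi_kf$ extends to a continuous function on $R^{k+1}$; $C^k(R,K)$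 is the set of these ($C^0$ = continuous functions). For $f\in C^k$ and $j\le k$, $D_jf(x)=\Phi_jf(x,\dots,x)$; $D_jf\in C^{k-j}$. For $f\in C^k$ and $0\le j\le k$, $\psi_jf:\nabla^2R\to K$ is $\psi_0f=\Phi_1f$, $\psi_jf(x,y)=\frac{f(x)-f(y)-\sum_{l=1}^j(x-y)^lD_lf(y)}{(x-y)^{j+1}}$. Norm: for $m\ge1$ and $f\in C^m(R,K)$, $|f|_m=\sup\big(\{|D_jf(0)|:0\le j\le m-1\}\cup\{|\psi_{m-1-j}D_jf(r,r_-)|: r\in\mathcal{R}_+,\,0\le j\le m-1\}\big)$. *)

theory Defs
  imports "HOL-Analysis.Analysis" "HOL-Computational_Algebra.Computational_Algebra"
begin

section \<open>Local fields\<close>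

text \<open>
  The field \<open>K\<close> is the type \<open>'a\<close>. A discrete valuation on it is a function
  \<open>v :: 'a \<Rightarrow> int\<close> whose value at \<open>0\<close> is never used (it stands for infinity); the discrete
  valuation ring \<open>R\<close> is the valuation ring of \<open>v\<close>, and \<open>K\<close> is its fraction field.
\<close>

definition val_ring :: "('a::field \<Rightarrow> int) \<Rightarrow> 'a set" where
  "val_ring v = {x. x = 0 \<or> v x \<ge> 0}"

definition max_ideal :: "('a::field \<Rightarrow> int) \<Rightarrow> 'a set" where
  "max_ideal v = {x. x = 0 \<or> v x \<ge> 1}"

definition residue_field :: "('a::field \<Rightarrow> int) \<Rightarrow> 'a set set" where
  "residue_field v =
     val_ring v // {(x, y). x \<in> val_ring v \<and> y \<in> val_ring v \<and> x - y \<in> max_ideal v}"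

definition absval :: "('a::field \<Rightarrow> int) \<Rightarrow> 'a \<Rightarrow> real" where
  "absval v x = (if x = 0 then 0 else real (card (residue_field v)) powi (- v x))"

text \<open>
  The metric of the type is required to be the one induced by the normalised absolute value, so
  that continuity and completeness are the usual notions for metric spaces.
\<close>

locale local_field =
  fixes v :: "'a::{field, metric_space} \<Rightarrow> int"
  assumes v_mult: "x \<noteq> 0 \<Longrightarrow> y \<noteq> 0 \<Longrightarrow> v (x * y) = v x + v y"
    and v_add: "x \<noteq> 0 \<Longrightarrow> y \<noteq> 0 \<Longrightarrow> x + y \<noteq> 0 \<Longrightarrow> v (x + y) \<ge> min (v x) (v y)"
    and v_surj: "v ` (UNIV - {0}) = UNIV"
    and finite_residue_field: "finite (residue_field v)"
    and dist_eq: "dist x y = absval v (x - y)"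
    and complete_val_ring: "complete (val_ring v)"

definition uniformizer :: "('a::field \<Rightarrow> int) \<Rightarrow> 'a \<Rightarrow> bool" where
  "uniformizer v \<pi> \<longleftrightarrow> \<pi> \<noteq> 0 \<and> v \<pi> = 1"

definition residue_representatives :: "('a::field \<Rightarrow> int) \<Rightarrow> 'a set \<Rightarrow> bool" where
  "residue_representatives v T \<longleftrightarrow>
     T \<subseteq> val_ring v \<and> 0 \<in> T \<and> (\<forall>x\<in>val_ring v. \<exists>!t. t \<in> T \<and> x - t \<in> max_ideal v)"


section \<open>Finite digit expansions\<close>

definition R_digits :: "'a::field \<Rightarrow> 'a set \<Rightarrow> nat \<Rightarrow> 'a set" where
  "R_digits \<pi> T m = {(\<Sum>i<m. a i * \<pi> ^ i) | a. \<forall>i<m. a i \<in> T}"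

definition R_plus :: "'a::field \<Rightarrow> 'a set \<Rightarrow> 'a set" where
  "R_plus \<pi> T = (\<Union>m\<in>{1..}. R_digits \<pi> T m)"

text \<open>
  \<open>r_minus \<pi> T r\<close> deletes the leading digit of \<open>r\<close>. It is meaningful only for nonzero
  \<open>r \<in> R_plus \<pi> T\<close>, since \<open>0\<close> has no leading digit.
\<close>

definition r_minus :: "'a::field \<Rightarrow> 'a set \<Rightarrow> 'a \<Rightarrow> 'a" where
  "r_minus \<pi> T r =
     (THE s. \<exists>a m. (\<forall>i\<le>m. a i \<in> T) \<and> a m \<noteq> 0 \<and>
                   r = (\<Sum>i\<le>m. a i * \<pi> ^ i) \<and> s = (\<Sum>i<m. a i * \<pi> ^ i))"


section \<open>Difference quotients and functions of class \<open>C\<^sup>k\<close>\<close>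

text \<open>
  A function \<open>f : R \<rightarrow> K\<close> is a function on \<open>'a\<close> of which only the values on \<open>val_ring v\<close> matter.
  A point \<open>(x\<^sub>1, \<dots>, x\<^sub>k)\<close> of \<open>R\<^sup>k\<close> is an extensional function \<open>x\<close> on \<open>{..<k}\<close>, with \<open>x\<^sub>i\<close> stored
  at index \<open>i - 1\<close>; the product topology on \<open>R\<^sup>k\<close> is the subspace topology of \<open>nat \<Rightarrow> 'a\<close>.
\<close>

definition R_pow :: "('a::field \<Rightarrow> int) \<Rightarrow> nat \<Rightarrow> (nat \<Rightarrow> 'a) set" where
  "R_pow v k = {..<k} \<rightarrow>\<^sub>E val_ring v"

definition nabla :: "('a::field \<Rightarrow> int) \<Rightarrow> nat \<Rightarrow> (nat \<Rightarrow> 'a) set" where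
  "nabla v k = {x \<in> R_pow v k. inj_on x {..<k}}"

text \<open>\<open>Phi k f x\<close> depends only on the first \<open>k + 1\<close> entries of \<open>x\<close>.\<close>

primrec Phi :: "nat \<Rightarrow> ('a::field \<Rightarrow> 'a) \<Rightarrow> (nat \<Rightarrow> 'a) \<Rightarrow> 'a" where
  "Phi 0 f x = f (x 0)"
| "Phi (Suc k) f x =
     (Phi k f (\<lambda>i. if i = 0 then x 0 else x (Suc i)) - Phi k f (\<lambda>i. x (Suc i))) / (x 0 - x 1)"

definition Phi_extension ::
  "('a::{field, metric_space} \<Rightarrow> int) \<Rightarrow> nat \<Rightarrow> ('a \<Rightarrow> 'a) \<Rightarrow> ((nat \<Rightarrow> 'a) \<Rightarrow> 'a) \<Rightarrow> bool" where
  "Phi_extension v k f g \<longleftrightarrow>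
     continuous_on (R_pow v (k + 1)) g \<and> (\<forall>x\<in>nabla v (k + 1). g x = Phi k f x)"

definition C_class :: "('a::{field, metric_space} \<Rightarrow> int) \<Rightarrow> nat \<Rightarrow> ('a \<Rightarrow> 'a) set" where
  "C_class v k = {f. \<exists>g. Phi_extension v k f g}"

text \<open>
  Since \<open>nabla v (k + 1)\<close> is dense in \<open>R_pow v (k + 1)\<close>, the extension is unique on
  \<open>R_pow v (k + 1)\<close>; the choice only concerns irrelevant values elsewhere.
\<close>

definition Phi_ext ::
  "('a::{field, metric_space} \<Rightarrow> int) \<Rightarrow> nat \<Rightarrow> ('a \<Rightarrow> 'a) \<Rightarrow> (nat \<Rightarrow> 'a) \<Rightarrow> 'a" where
  "Phi_ext v k f = (SOME g. Phi_extension v k f g)"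

definition D_op :: "('a::{field, metric_space} \<Rightarrow> int) \<Rightarrow> nat \<Rightarrow> ('a \<Rightarrow> 'a) \<Rightarrow> 'a \<Rightarrow> 'a" where
  "D_op v j f x = Phi_ext v j f (\<lambda>i\<in>{..<j + 1}. x)"

definition psi ::
  "('a::{field, metric_space} \<Rightarrow> int) \<Rightarrow> nat \<Rightarrow> ('a \<Rightarrow> 'a) \<Rightarrow> 'a \<Rightarrow> 'a \<Rightarrow> 'a" where
  "psi v j f x y = (f x - f y - (\<Sum>l=1..j. (x - y) ^ l * D_op v l f y)) / (x - y) ^ (j + 1)"

lemma psi_0: "psi v 0 f (x 0) (x 1) = Phi 1 f x"
  by (simp add: psi_def)


section \<open>The two norms\<close>

text \<open>
  Both are suprema of nonnegative quantities, taken in the extended reals so that they make sense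
  without a prior proof of boundedness.
\<close>

definition norm_digits ::
  "('a::{field, metric_space} \<Rightarrow> int) \<Rightarrow> 'a \<Rightarrow> 'a set \<Rightarrow> nat \<Rightarrow> ('a \<Rightarrow> 'a) \<Rightarrow> ereal" where
  "norm_digits v \<pi> T m f =
     Sup ({ereal (absval v (D_op v j f 0)) | j. j \<le> m - 1} \<union>
          {ereal (absval v (psi v (m - 1 - j) (D_op v j f) r (r_minus \<pi> T r))) | r j.
             r \<in> R_plus \<pi> T \<and> r \<noteq> 0 \<and> j \<le> m - 1})"

definition norm_C :: "('a::{field, metric_space} \<Rightarrow> int) \<Rightarrow> nat \<Rightarrow> ('a \<Rightarrow> 'a) \<Rightarrow> ereal" where
  "norm_C v n f =
     Max ((\<lambda>j. SUP x\<in>R_pow v (j + 1). ereal (absval v (Phi_ext v j f x))) ` {0..n})"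

end

theory Submission
  imports Defs
begin

text \<open>
  The extension of \<open>\<Phi>\<^sub>k f\<close> to \<open>R\<^sup>k\<^sup>+\<^sup>1\<close> is a symmetric function obeying the divided difference recursion
  also at coinciding arguments. Consequently \<open>\<psi>\<^sub>n\<^sub>-\<^sub>1\<^sub>-\<^sub>j D\<^sub>j f (x, y)\<close> is a value of the extended difference
  quotient of \<open>D\<^sub>j f\<close>, which is a sum of values of the extension of \<open>\<Phi>\<^sub>n f\<close>; this bounds the digit norm
  by the \<open>C\<^sup>n\<close> norm.

  Conversely let \<open>f\<^sub>m x\<close> be the value at \<open>x\<close> of the Taylor polynomial of degree \<open>n - 1\<close> of \<open>f\<close> centred at
  the truncation of \<open>x\<close> to \<open>m\<close> digits. Then \<open>f\<^sub>m \<rightarrow> f\<close> pointwise, and \<open>f\<^sub>m\<^sub>+\<^sub>1 - f\<^sub>m\<close> is a sum of terms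
  \<open>\<psi>\<^sub>n\<^sub>-\<^sub>1\<^sub>-\<^sub>i D\<^sub>i f (r, r\<^sub>-) (r - r\<^sub>-)\<^sup>n\<^sup>-\<^sup>i (x - r)\<^sup>i\<close>, each cut off to the ball of those \<open>x\<close> whose truncation
  to \<open>m + 1\<close> digits is \<open>r\<close>. Since this ball has distance at least \<open>\<bar>\<pi>\<bar>\<^sup>m\<close> from its complement, all
  difference quotients of order at most \<open>n\<close> of the cut-off of \<open>(r - r\<^sub>-)\<^sup>n\<^sup>-\<^sup>i (x - r)\<^sup>i\<close> have absolute value
  at most \<open>1\<close>, and the ultrametric inequality gives the bound.
\<close>

section \<open>Divided differences over finite sets\<close>

text \<open>The Lagrange form of the divided difference, that is, the leading coefficient of the
  polynomial interpolating \<open>f\<close> on \<open>S\<close>. Indexing by a set makes the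
  symmetry in the arguments automatic.\<close>

definition ddiff :: "('a::field \<Rightarrow> 'a) \<Rightarrow> 'a set \<Rightarrow> 'a" where
  "ddiff f S = (\<Sum>s\<in>S. f s / (\<Prod>t\<in>S - {s}. s - t))"

lemma ddiff_empty [simp]: "ddiff f {} = 0"
  by (simp add: ddiff_def)

lemma ddiff_singleton [simp]: "ddiff f {a} = f a"
  by (simp add: ddiff_def)

lemma ddiff_cong: "(\<And>s. s \<in> S \<Longrightarrow> f s = g s) \<Longrightarrow> ddiff f S = ddiff g S"
  by (simp add: ddiff_def)

lemma ddiff_zero: "(\<And>s. s \<in> S \<Longrightarrow> f s = 0) \<Longrightarrow> ddiff f S = 0"
  by (simp add: ddiff_def)

lemma ddiff_add: "ddiff (\<lambda>x. f x + g x) S = ddiff f S + ddiff g S"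
  by (simp add: ddiff_def sum.distrib add_divide_distrib)

lemma ddiff_cmult: "ddiff (\<lambda>x. c * f x) S = c * ddiff f S"
  by (simp add: ddiff_def sum_distrib_left)

lemma ddiff_sum: "ddiff (\<lambda>x. \<Sum>i\<in>I. f i x) S = (\<Sum>i\<in>I. ddiff (f i) S)"
  unfolding ddiff_def by (simp add: sum_divide_distrib) (rule sum.swap)

lemma ddiff_insert:
  assumes "finite S" "a \<notin> S"
  shows "ddiff f (insert a S) =
    f a / (\<Prod>t\<in>S. a - t) + (\<Sum>s\<in>S. f s / ((s - a) * (\<Prod>t\<in>S - {s}. s - t)))"
proof -
  have "insert a S - {s} = insert a (S - {s})" if "s \<in> S" for s
    using that assms by auto
  moreover have "insert a S - {a} = S"
    using assms by auto
  ultimately show ?thesis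
    using assms by (simp add: ddiff_def)
qed

text \<open>Compare the coefficient of each \<open>f s\<close>: for \<open>s\<close> in
  \<open>S\<close> it rests on
  \<open>(a - b) / ((s - a) * (s - b)) = 1 / (s - a) - 1 / (s - b)\<close>. Multiplying by
  \<open>a - b\<close> instead of dividing gives a form that passes to coinciding arguments
  later.\<close>

lemma ddiff_rec:
  assumes S: "finite S" "a \<notin> S" "b \<notin> S" "a \<noteq> b"
  shows "(a - b) * ddiff f (insert a (insert b S)) = ddiff f (insert a S) - ddiff f (insert b S)"
proof -
  define P where "P s = (\<Prod>t\<in>S - {s}. s - t)" for s
  define Pa where "Pa = (\<Prod>t\<in>S. a - t)"
  define Pb where "Pb = (\<Prod>t\<in>S. b - t)"
  have ab: "a - b \<noteq> 0" "b - a \<noteq> 0"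
    using S by auto
  have "ddiff f (insert a (insert b S)) = f a / ((a - b) * Pa) + f b / ((b - a) * Pb) +
      (\<Sum>s\<in>S. f s / ((s - a) * ((s - b) * P s)))"
  proof -
    have "insert b S - {s} = insert b (S - {s})" if "s \<in> S" for s
      using that S by auto
    moreover have "insert b S - {b} = S"
      using S by auto
    ultimately show ?thesis
      using S by (subst ddiff_insert) (auto simp: Pa_def Pb_def P_def intro!: sum.cong)
  qed
  moreover have "(a - b) * (f a / ((a - b) * Pa)) = f a / Pa"
    using ab by simp
  moreover have "(a - b) * (f b / ((b - a) * Pb)) = - (f b / Pb)"
  proof -
    have "(a - b) * (f b / ((b - a) * Pb)) = - ((b - a) * (f b / ((b - a) * Pb)))"
      by (metis minus_diff_eq mult_minus_left)
    with ab show ?thesis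
      by simp
  qed
  ultimately have "(a - b) * ddiff f (insert a (insert b S)) = f a / Pa - f b / Pb +
      (\<Sum>s\<in>S. (a - b) * (f s / ((s - a) * ((s - b) * P s))))"
    by (simp add: distrib_left sum_distrib_left)
  also have "(\<Sum>s\<in>S. (a - b) * (f s / ((s - a) * ((s - b) * P s)))) =
      (\<Sum>s\<in>S. f s / ((s - a) * P s) - f s / ((s - b) * P s))"
  proof (rule sum.cong)
    fix s assume "s \<in> S"
    then have "s - a \<noteq> 0" "s - b \<noteq> 0"
      using S by auto
    moreover have "P s \<noteq> 0"
      unfolding P_def using S by (subst prod_zero_iff) auto
    ultimately show "(a - b) * (f s / ((s - a) * ((s - b) * P s))) =
        f s / ((s - a) * P s) - f s / ((s - b) * P s)"
      by (simp add: divide_simps) (simp add: algebra_simps)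
  qed auto
  finally show ?thesis
    using S by (simp add: ddiff_insert Pa_def Pb_def P_def sum_subtractf)
qed

text \<open>The factor \<open>x - a\<close> kills the term at \<open>a\<close> and cancels the
  factor \<open>s - a\<close> in all other denominators.\<close>

lemma ddiff_mult_root:
  assumes "finite S" "a \<notin> S"
  shows "ddiff (\<lambda>x. (x - a) * g x) (insert a S) = ddiff g S"
proof -
  have "(s - a) * g s / ((s - a) * Q) = g s / Q" if "s \<in> S" for s Q
    using that assms by auto
  then show ?thesis
    using assms by (simp add: ddiff_insert) (simp add: ddiff_def)
qed

text \<open>Leibniz rule for a linear factor, from \<open>x - r = (a - r) + (x - a)\<close>. The
  node \<open>a\<close> is free in \<open>S\<close>, so it can be chosen to make
  \<open>a - r\<close> small.\<close>

lemma ddiff_mult_linear: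
  assumes "finite S" "a \<in> S"
  shows "ddiff (\<lambda>x. (x - r) * g x) S = (a - r) * ddiff g S + ddiff g (S - {a})"
proof -
  have "ddiff (\<lambda>x. (x - r) * g x) S = ddiff (\<lambda>x. (a - r) * g x + (x - a) * g x) S"
    by (rule ddiff_cong) (simp add: algebra_simps)
  also have "\<dots> = (a - r) * ddiff g S + ddiff (\<lambda>x. (x - a) * g x) (insert a (S - {a}))"
    using assms by (simp add: ddiff_add ddiff_cmult insert_absorb)
  also have "\<dots> = (a - r) * ddiff g S + ddiff g (S - {a})"
    using assms by (subst ddiff_mult_root) auto
  finally show ?thesis .
qed

lemma card_ge_2_obtain:
  assumes "finite S" "card S \<ge> 2"
  obtains a b S' where "S = insert a (insert b S')" "a \<noteq> b" "a \<notin> S'" "b \<notin> S'" "finite S'"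
proof -
  obtain a b where ab: "a \<in> S" "b \<in> S" "a \<noteq> b"
    using assms by (metis card_le_Suc0_iff_eq not_numeral_le_zero numeral_2_eq_2 not_less_eq_eq)
  show ?thesis
    using ab assms that[of a b "S - {a, b}"] by auto
qed

lemma ddiff_const:
  assumes "finite S" "card S \<ge> 2"
  shows "ddiff (\<lambda>_. c) S = 0"
  using assms
proof (induction "card S" arbitrary: S rule: less_induct)
  case less
  obtain a b S' where S: "S = insert a (insert b S')" "a \<noteq> b" "a \<notin> S'" "b \<notin> S'" "finite S'"
    using card_ge_2_obtain less.prems by blast
  have "ddiff (\<lambda>_. c) (insert a S') = ddiff (\<lambda>_. c) (insert b S')"
  proof (cases "S' = {}")
    case False
    then have "Suc 0 \<le> card S'"
      using S by (simp add: Suc_le_eq card_gt_0_iff)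
    then show ?thesis
      using S less.hyps[of "insert a S'"] less.hyps[of "insert b S'"] by simp
  qed simp
  with ddiff_rec[OF S(5,3,4,2), of "\<lambda>_. c"] S show ?case
    by simp
qed

text \<open>Both sides obey the same recursion: the two tuples in \<open>Phi (Suc k)\<close> share
  the entries from index 2 on and differ in carrying \<open>x 0\<close> or
  \<open>x 1\<close>.\<close>

lemma Phi_eq_ddiff: "inj_on x {..k} \<Longrightarrow> Phi k f x = ddiff f (x ` {..k})"
proof (induction k arbitrary: x)
  case (Suc k)
  define S where "S = x ` {2..Suc k}"
  have less: "i \<le> Suc k \<Longrightarrow> j \<le> Suc k \<Longrightarrow> x i = x j \<Longrightarrow> i = j" for i j
    using Suc.prems by (auto simp: inj_on_def)
  have x01: "x 0 \<noteq> x 1" "x 0 \<notin> S" "x 1 \<notin> S" "finite S"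
    using less[of 0 1] by (auto simp: S_def dest!: less[rotated 2])
  have split: "{..k} = insert 0 {1..k}" and shift: "S = (\<lambda>i. x (Suc i)) ` {1..k}"
    by (auto simp: S_def image_Suc_atLeastAtMost numeral_2_eq_2 simp flip: image_image[of x Suc])
  have "(\<lambda>i. if i = 0 then x 0 else x (Suc i)) ` {..k} = insert (x 0) S"
    unfolding split shift by (simp, rule arg_cong[where f = "insert (x 0)"], rule image_cong) auto
  moreover have "(\<lambda>i. x (Suc i)) ` {..k} = insert (x 1) S"
    unfolding split shift by simp
  moreover have "x ` {..Suc k} = insert (x 0) (insert (x 1) S)"
  proof -
    have "{..Suc k} = insert 0 (insert 1 {2..Suc k})"
      by auto
    then show ?thesis
      by (simp add: S_def)
  qed
  have less2: "x i = x j \<longleftrightarrow> i = j" if "i \<le> Suc k" "j \<le> Suc k" for i j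
    using less that by blast
  moreover have "inj_on (\<lambda>i. if i = 0 then x 0 else x (Suc i)) {..k}"
    by (rule inj_onI) (auto simp: less2 split: if_splits)
  moreover have "inj_on (\<lambda>i. x (Suc i)) {..k}"
    by (rule inj_onI) (auto simp: less2)
  ultimately have "Phi (Suc k) f x =
      (ddiff f (insert (x 0) S) - ddiff f (insert (x 1) S)) / (x 0 - x 1)"
    by (simp add: Suc.IH)
  also have "\<dots> = ddiff f (x ` {..Suc k})"
    using ddiff_rec[OF x01(4,2,3,1), of f] x01(1) \<open>x ` {..Suc k} = _\<close>
    by (simp add: field_simps)
  finally show ?case .
qed simp


section \<open>Arithmetic and topology of a local field\<close>

context local_field
begin

abbreviation N :: "'a \<Rightarrow> real" where "N \<equiv> absval v"

abbreviation R :: "'a set" where "R \<equiv> val_ring v"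

abbreviation q :: real where "q \<equiv> real (card (residue_field v))"

lemma v_one [simp]: "v 1 = 0"
  using v_mult[of 1 1] by simp

lemma v_minus_one [simp]: "v (- 1) = 0"
  using v_mult[of "-1" "-1"] by simp

lemma v_uminus [simp]: "v (- x) = v x"
  using v_mult[of "-1" x] by (cases "x = 0") auto

lemma val_ring_add: "x \<in> R \<Longrightarrow> y \<in> R \<Longrightarrow> x + y \<in> R"
  using v_add[of x y] by (cases "x = 0"; cases "y = 0"; cases "x + y = 0") (auto simp: val_ring_def)

lemma val_ring_mult: "x \<in> R \<Longrightarrow> y \<in> R \<Longrightarrow> x * y \<in> R"
  by (cases "x = 0"; cases "y = 0") (auto simp: val_ring_def v_mult)

lemma val_ring_uminus: "x \<in> R \<Longrightarrow> - x \<in> R"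
  by (auto simp: val_ring_def)

lemma val_ring_diff: "x \<in> R \<Longrightarrow> y \<in> R \<Longrightarrow> x - y \<in> R"
  using val_ring_add[of x "- y"] val_ring_uminus[of y] by simp

lemma zero_in_val_ring [simp]: "0 \<in> R"
  by (simp add: val_ring_def)

lemma one_in_val_ring [simp]: "1 \<in> R"
  by (simp add: val_ring_def)

lemma val_ring_power: "x \<in> R \<Longrightarrow> x ^ k \<in> R"
  by (induction k) (auto intro: val_ring_mult)

lemma val_ring_sum: "(\<And>i. i \<in> I \<Longrightarrow> f i \<in> R) \<Longrightarrow> sum f I \<in> R"
  by (induction I rule: infinite_finite_induct) (auto intro: val_ring_add)

lemma max_ideal_add: "x \<in> max_ideal v \<Longrightarrow> y \<in> max_ideal v \<Longrightarrow> x + y \<in> max_ideal v"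
  using v_add[of x y] by (cases "x = 0"; cases "y = 0"; cases "x + y = 0") (auto simp: max_ideal_def)

text \<open>The residue classes of 0 and 1 differ, as 1 has valuation 0.\<close>

lemma q_gt_1: "q > 1"
proof -
  define E where "E = {(x, y). x \<in> R \<and> y \<in> R \<and> x - y \<in> max_ideal v}"
  have "E `` {0} \<in> residue_field v" "E `` {1} \<in> residue_field v"
    unfolding residue_field_def E_def[symmetric] by (simp_all add: quotientI)
  moreover have "0 \<in> E `` {0}" "0 \<notin> E `` {1}"
    by (auto simp: E_def max_ideal_def)
  ultimately have "card {E `` {0}, E `` {1}} \<le> card (residue_field v)" "E `` {0} \<noteq> E `` {1}"
    using finite_residue_field by (auto intro!: card_mono)
  then show ?thesis
    by simp
qed

lemma absval_0 [simp]: "N 0 = 0"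
  by (simp add: absval_def)

lemma absval_pos: "x \<noteq> 0 \<Longrightarrow> N x > 0"
  using q_gt_1 by (simp add: absval_def)

lemma absval_nonneg [simp]: "N x \<ge> 0"
  using absval_pos[of x] by (cases "x = 0") auto

lemma absval_eq_0_iff [simp]: "N x = 0 \<longleftrightarrow> x = 0"
  using absval_pos[of x] by (cases "x = 0") auto

lemma absval_mult: "N (x * y) = N x * N y"
  using q_gt_1 by (auto simp: absval_def v_mult power_int_diff power_int_minus field_simps)

lemma absval_1 [simp]: "N 1 = 1"
  by (simp add: absval_def)

lemma absval_power: "N (x ^ k) = N x ^ k"
  by (induction k) (auto simp: absval_mult)

lemma absval_uminus [simp]: "N (- x) = N x"
  by (simp add: absval_def)

lemma absval_diff_commute: "N (x - y) = N (y - x)"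
  by (metis absval_uminus minus_diff_eq)

lemma absval_divide: "N (x / y) = N x / N y"
proof (cases "y = 0")
  case False
  then have "N x = N (x / y) * N y"
    by (simp flip: absval_mult)
  with False show ?thesis
    by simp
qed auto

lemma absval_add: "N (x + y) \<le> max (N x) (N y)"
proof (cases "x = 0 \<or> y = 0 \<or> x + y = 0")
  case False
  then have "- v (x + y) \<le> max (- v x) (- v y)"
    using v_add[of x y] by auto
  then have "q powi (- v (x + y)) \<le> q powi (max (- v x) (- v y))"
    using q_gt_1 by (intro power_int_increasing) auto
  with False show ?thesis
    by (auto simp: absval_def max_def split: if_splits)
qed (auto simp: max_def)

lemma absval_diff: "N (x - y) \<le> max (N x) (N y)"
  using absval_add[of x "- y"] by simp

lemma absval_add_le: "N x \<le> B \<Longrightarrow> N y \<le> B \<Longrightarrow> N (x + y) \<le> B"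
  using absval_add[of x y] by simp

lemma absval_diff_le: "N x \<le> B \<Longrightarrow> N y \<le> B \<Longrightarrow> N (x - y) \<le> B"
  using absval_diff[of x y] by simp

lemma absval_sum_le: "0 \<le> B \<Longrightarrow> (\<And>i. i \<in> I \<Longrightarrow> N (f i) \<le> B) \<Longrightarrow> N (sum f I) \<le> B"
  by (induction I rule: infinite_finite_induct) (auto intro: absval_add_le)

lemma dist_absval: "dist x y = N (x - y)"
  by (rule dist_eq)

lemma val_ring_iff_absval: "x \<in> R \<longleftrightarrow> N x \<le> 1"
proof (cases "x = 0")
  case False
  have "q powi (- v x) \<le> q powi 0 \<longleftrightarrow> - v x \<le> 0"
    using q_gt_1 power_int_increasing[of "- v x" 0 q] power_int_strict_increasing[of 0 "- v x" q]
    by linarith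
  with False show ?thesis
    by (simp add: val_ring_def absval_def)
qed simp

section \<open>Continuity of the field operations\<close>

lemma tendsto_absval_iff: "(f \<longlongrightarrow> a) F \<longleftrightarrow> ((\<lambda>x. N (f x - a)) \<longlongrightarrow> 0) F"
  by (subst tendsto_dist_iff) (simp add: dist_absval)

text \<open>Metric and arithmetic are tied together only by \<open>dist_eq\<close>, so continuity of
  each operation is obtained by dominating the error with a null function.\<close>

lemma tendsto_absval_bound:
  assumes "(B \<longlongrightarrow> 0) F" "\<And>x. N (f x - a) \<le> B x"
  shows "(f \<longlongrightarrow> a) F"
  unfolding tendsto_absval_iff[of f a]
  by (rule tendsto_sandwich[OF _ _ tendsto_const assms(1)]) (simp_all add: assms(2))

lemma tendsto_add_lf:
  fixes f g :: "'b \<Rightarrow> 'a"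
  assumes "(f \<longlongrightarrow> a) F" "(g \<longlongrightarrow> b) F"
  shows "((\<lambda>x. f x + g x) \<longlongrightarrow> a + b) F"
proof -
  have "((\<lambda>x. max (N (f x - a)) (N (g x - b))) \<longlongrightarrow> max 0 0) F"
    using assms by (intro tendsto_max) (simp_all add: tendsto_absval_iff)
  moreover have "N (f x + g x - (a + b)) \<le> max (N (f x - a)) (N (g x - b))" for x
    using absval_add[of "f x - a" "g x - b"] by (simp add: algebra_simps)
  ultimately show ?thesis
    by (intro tendsto_absval_bound[of "\<lambda>x. max (N (f x - a)) (N (g x - b))"]) simp_all
qed

lemma tendsto_mult_lf:
  fixes f g :: "'b \<Rightarrow> 'a"
  assumes "(f \<longlongrightarrow> a) F" "(g \<longlongrightarrow> b) F"
  shows "((\<lambda>x. f x * g x) \<longlongrightarrow> a * b) F"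
proof -
  define B where "B x = N (f x - a) * N (g x - b) + N a * N (g x - b) + N (f x - a) * N b" for x
  have "(B \<longlongrightarrow> 0 * 0 + N a * 0 + 0 * N b) F"
    unfolding B_def using assms by (intro tendsto_intros) (simp_all add: tendsto_absval_iff)
  moreover have "N (f x * g x - a * b) \<le> B x" for x
  proof -
    have "f x * g x - a * b = (f x - a) * (g x - b) + a * (g x - b) + (f x - a) * b"
      by (simp add: algebra_simps)
    moreover have "N (u + w + z) \<le> N u + N w + N z" for u w z
      using absval_add[of "u + w" z] absval_add[of u w] absval_nonneg[of u] absval_nonneg[of w]
        absval_nonneg[of z] by linarith
    ultimately show ?thesis
      by (simp add: B_def flip: absval_mult)
  qed
  ultimately show ?thesis
    by (intro tendsto_absval_bound[of B]) simp_all
qed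

lemma tendsto_diff_lf:
  fixes f g :: "'b \<Rightarrow> 'a"
  assumes "(f \<longlongrightarrow> a) F" "(g \<longlongrightarrow> b) F"
  shows "((\<lambda>x. f x - g x) \<longlongrightarrow> a - b) F"
proof -
  have "((\<lambda>x. f x + - 1 * g x) \<longlongrightarrow> a + - 1 * b) F"
    by (intro tendsto_add_lf tendsto_mult_lf tendsto_const assms)
  then show ?thesis
    by simp
qed

lemma tendsto_sum_lf:
  fixes f :: "'c \<Rightarrow> 'b \<Rightarrow> 'a"
  shows "(\<And>i. i \<in> I \<Longrightarrow> (f i \<longlongrightarrow> a i) F) \<Longrightarrow> ((\<lambda>x. \<Sum>i\<in>I. f i x) \<longlongrightarrow> (\<Sum>i\<in>I. a i)) F"
  by (induction I rule: infinite_finite_induct) (simp_all add: tendsto_add_lf)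

lemma tendsto_power_lf:
  fixes f :: "'b \<Rightarrow> 'a"
  shows "(f \<longlongrightarrow> a) F \<Longrightarrow> ((\<lambda>x. f x ^ k) \<longlongrightarrow> a ^ k) F"
  by (induction k) (simp_all add: tendsto_mult_lf)

lemma tendsto_absval: "(f \<longlongrightarrow> a) F \<Longrightarrow> ((\<lambda>x. N (f x)) \<longlongrightarrow> N a) F"
  using tendsto_dist[of f a F "\<lambda>_. 0" 0] by (simp add: dist_absval)

lemma continuous_on_diff_lf:
  "continuous_on S f \<Longrightarrow> continuous_on S g \<Longrightarrow> continuous_on S (\<lambda>x. f x - g x :: 'a)"
  by (simp add: continuous_on_def tendsto_diff_lf)

lemma continuous_on_mult_lf:
  "continuous_on S f \<Longrightarrow> continuous_on S g \<Longrightarrow> continuous_on S (\<lambda>x. f x * g x :: 'a)"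
  by (simp add: continuous_on_def tendsto_mult_lf)

lemma continuous_on_add_lf:
  "continuous_on S f \<Longrightarrow> continuous_on S g \<Longrightarrow> continuous_on S (\<lambda>x. f x + g x :: 'a)"
  by (simp add: continuous_on_def tendsto_add_lf)

lemma continuous_on_sum_lf:
  "(\<And>i. i \<in> I \<Longrightarrow> continuous_on S (f i)) \<Longrightarrow> continuous_on S (\<lambda>x. \<Sum>i\<in>I. f i x :: 'a)"
  by (simp add: continuous_on_def tendsto_sum_lf)

end

section \<open>Extending difference quotients to coinciding arguments\<close>

text \<open>Converts lists, which are convenient to extend, cut and permute, into the extensional
  functions that represent points of \<open>R_pow\<close>.\<close>

definition tuple_of :: "'a list \<Rightarrow> nat \<Rightarrow> 'a" where
  "tuple_of xs = (\<lambda>i\<in>{..<length xs}. xs ! i)"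

lemma map_tuple_of: "map (tuple_of xs) [0..<length xs] = xs"
  by (rule nth_equalityI) (simp_all add: tuple_of_def)

lemma image_tuple_of: "tuple_of xs ` {..<length xs} = set xs"
  by (auto simp: tuple_of_def set_conv_nth image_iff)

lemma inj_on_tuple_of: "inj_on (tuple_of xs) {..<length xs} \<longleftrightarrow> distinct xs"
  by (simp add: inj_on_def tuple_of_def distinct_conv_nth) blast

lemma tuple_of_in_R_pow: "set xs \<subseteq> val_ring v \<Longrightarrow> tuple_of xs \<in> R_pow v (length xs)"
  unfolding R_pow_def PiE_def by (auto simp: tuple_of_def dest: nth_mem)

lemma tuple_of_map_upt: "x \<in> R_pow v k \<Longrightarrow> tuple_of (map x [0..<k]) = x"
  by (rule ext) (auto simp: R_pow_def PiE_def tuple_of_def extensional_def)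

lemma tuple_of_replicate: "tuple_of (replicate k c) = (\<lambda>i\<in>{..<k}. c)"
  by (rule ext) (simp add: tuple_of_def)

lemma R_pow_component: "x \<in> R_pow v k \<Longrightarrow> i < k \<Longrightarrow> x i \<in> val_ring v"
  by (auto simp: R_pow_def)

lemma set_map_R_pow: "x \<in> R_pow v k \<Longrightarrow> set is \<subseteq> {..<k} \<Longrightarrow> set (map x is) \<subseteq> val_ring v"
  by (auto simp: R_pow_component subset_iff)

lemma tendsto_product_componentwise:
  fixes f :: "'b \<Rightarrow> 'i \<Rightarrow> 'c::topological_space"
  shows "(f \<longlongrightarrow> l) F \<longleftrightarrow> (\<forall>i. ((\<lambda>c. f c i) \<longlongrightarrow> l i) F)"
  using limitin_componentwise[of "\<lambda>_. euclidean :: 'c topology" UNIV f l F]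
  by (simp add: euclidean_product_topology)

lemma continuous_on_component: "continuous_on S (\<lambda>x :: 'i \<Rightarrow> 'c::topological_space. x i)"
  by (rule continuous_on_product_then_coordinatewise) (rule continuous_on_id)

context local_field
begin

text \<open>The order of the quotient is read off from the length, so a single function covers all
  orders; the empty list falls back to order 0 and has no meaning.\<close>

definition PhiL :: "('a \<Rightarrow> 'a) \<Rightarrow> 'a list \<Rightarrow> 'a" where
  "PhiL f xs = Phi_ext v (length xs - 1) f (tuple_of xs)"

definition list_continuous :: "nat \<Rightarrow> ('a list \<Rightarrow> 'a) \<Rightarrow> bool" where
  "list_continuous k G \<longleftrightarrow> continuous_on (R_pow v k) (\<lambda>x. G (map x [0..<k]))"

lemma uniformizer_exists: "\<exists>\<pi>. \<pi> \<noteq> 0 \<and> v \<pi> = 1"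
  using v_surj by (metis DiffE UNIV_I imageE singletonI)

lemma absval_uniformizer:
  assumes "\<pi> \<noteq> 0" "v \<pi> = 1"
  shows "N \<pi> = 1 / q" "0 < N \<pi>" "N \<pi> < 1"
proof -
  have "N \<pi> = inverse q"
    using assms by (simp add: absval_def power_int_minus)
  moreover have "0 < inverse q" "inverse q < 1"
    using q_gt_1 one_less_inverse_iff[of "inverse q"] by auto
  ultimately show "N \<pi> = 1 / q" "0 < N \<pi>" "N \<pi> < 1"
    by (simp_all add: divide_inverse)
qed

section \<open>Density of tuples with distinct entries\<close>

lemma nabla_dense:
  assumes x: "x \<in> R_pow v k" and A: "finite A"
  obtains y where "\<And>m. y m \<in> nabla v k" "\<And>m. y m ` {..<k} \<inter> A = {}" "y \<longlonglongrightarrow> x"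
proof -
  obtain \<pi> where \<pi>: "\<pi> \<noteq> 0" "v \<pi> = 1"
    using uniformizer_exists by blast
  note N\<pi> = absval_uniformizer[OF \<pi>]
  have inj: "\<pi> ^ i = \<pi> ^ j \<longleftrightarrow> i = j" for i j
  proof
    assume "\<pi> ^ i = \<pi> ^ j"
    then have "N \<pi> ^ i = N \<pi> ^ j"
      by (simp flip: absval_power)
    then show "i = j"
      using N\<pi> by (metis power_inject_exp' less_numeral_extra(3) order_less_imp_not_eq2)
  qed simp
  \<comment> \<open>Perturbing the \<open>i\<close>-th coordinate by \<open>\<pi>\<^sup>m\<^sup>+\<^sup>i\<close>, each coincidence to be avoided occurs for at most one \<open>m\<close>.\<close>
  have fin: "finite {m. c * \<pi> ^ m = d}" if "c \<noteq> 0" for c d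
  proof (rule finite_subset)
    show "{m. c * \<pi> ^ m = d} \<subseteq> {LEAST m. c * \<pi> ^ m = d}"
    proof safe
      fix m assume m: "d = c * \<pi> ^ m"
      have "(LEAST m'. c * \<pi> ^ m' = c * \<pi> ^ m) = m"
        using that inj by (intro Least_equality) auto
      then show "m = (LEAST m'. c * \<pi> ^ m' = c * \<pi> ^ m)"
        by simp
    qed
  qed simp
  define z where "z m = (\<lambda>i\<in>{..<k}. x i + \<pi> ^ (m + i))" for m
  have R: "z m \<in> R_pow v k" for m
  proof -
    have "\<pi> \<in> R"
      using \<pi> by (simp add: val_ring_def)
    then have "x i + \<pi> ^ (m + i) \<in> R" if "i < k" for i
      using R_pow_component[OF x that] by (intro val_ring_add val_ring_power)
    then show ?thesis
      unfolding R_pow_def z_def by (auto intro!: restrict_PiE)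
  qed
  define bad where "bad = (\<Union>i<k. \<Union>a\<in>A. {m. \<pi> ^ i * \<pi> ^ m = a - x i}) \<union>
    (\<Union>i<k. \<Union>j\<in>{..<k} - {i}. {m. (\<pi> ^ i - \<pi> ^ j) * \<pi> ^ m = x j - x i})"
  have "finite bad"
    unfolding bad_def using A \<pi> by (intro finite_UnI finite_UN_I fin) (auto simp: inj)
  then obtain M where M: "\<And>m. m \<ge> M \<Longrightarrow> m \<notin> bad"
    using finite_nat_set_iff_bounded_le by (metis Suc_n_not_le_n le_trans)
  show ?thesis
  proof (rule that[of "\<lambda>m. z (m + M)"])
    fix m
    have nb: "m + M \<notin> bad"
      by (rule M) simp
    have "inj_on (z (m + M)) {..<k}"
    proof (rule inj_onI, rule ccontr)
      fix i j assume ij: "i \<in> {..<k}" "j \<in> {..<k}" "z (m + M) i = z (m + M) j" "i \<noteq> j"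
      then have "(\<pi> ^ i - \<pi> ^ j) * \<pi> ^ (m + M) = x j - x i"
        by (simp add: z_def power_add algebra_simps)
      with ij nb show False
        unfolding bad_def by blast
    qed
    with R show "z (m + M) \<in> nabla v k"
      by (simp add: nabla_def)
    show "z (m + M) ` {..<k} \<inter> A = {}"
    proof (rule ccontr)
      assume "z (m + M) ` {..<k} \<inter> A \<noteq> {}"
      then obtain i where i: "i < k" "z (m + M) i \<in> A"
        by auto
      then have "\<pi> ^ i * \<pi> ^ (m + M) = z (m + M) i - x i"
        by (simp add: z_def power_add algebra_simps)
      with i nb show False
        unfolding bad_def by blast
    qed
  next
    show "(\<lambda>m. z (m + M)) \<longlonglongrightarrow> x"
      unfolding tendsto_product_componentwise
    proof (intro allI LIMSEQ_ignore_initial_segment)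
      fix i
      show "(\<lambda>m. z m i) \<longlonglongrightarrow> x i"
      proof (cases "i < k")
        case True
        have "(\<lambda>m. N \<pi> ^ m * N \<pi> ^ i) \<longlonglongrightarrow> 0 * N \<pi> ^ i"
          using N\<pi> by (intro tendsto_intros LIMSEQ_power_zero) simp
        then show ?thesis
          using True by (subst tendsto_absval_iff) (simp add: z_def absval_mult absval_power power_add)
      next
        case False
        then show ?thesis
          using x by (auto simp: z_def R_pow_def PiE_def extensional_def)
      qed
    qed
  qed
qed

lemma dense_lists:
  assumes A: "finite A" and xs: "length xs = k" "set xs \<subseteq> R"
  obtains ys where "\<And>m. length (ys m) = k" "\<And>m. distinct (ys m)" "\<And>m. set (ys m) \<subseteq> R - A"
    "\<And>G. list_continuous k G \<Longrightarrow> (\<lambda>m. G (ys m)) \<longlonglongrightarrow> G xs"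
proof -
  have x: "tuple_of xs \<in> R_pow v k"
    using tuple_of_in_R_pow xs by blast
  obtain y where y: "\<And>m. y m \<in> nabla v k" "\<And>m. y m ` {..<k} \<inter> A = {}" "y \<longlonglongrightarrow> tuple_of xs"
    using nabla_dense[OF x A] by blast
  have yR: "y m \<in> R_pow v k" for m
    using y(1) by (simp add: nabla_def)
  show ?thesis
  proof (rule that[of "\<lambda>m. map (y m) [0..<k]"])
    show "distinct (map (y m) [0..<k])" for m
      using y(1)[of m] by (simp add: nabla_def distinct_map lessThan_atLeast0)
    show "set (map (y m) [0..<k]) \<subseteq> R - A" for m
      using y(2)[of m] yR[of m] by (fastforce simp: R_pow_def)
    show "(\<lambda>m. G (map (y m) [0..<k])) \<longlonglongrightarrow> G xs" if "list_continuous k G" for G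
      using continuous_on_tendsto_compose[OF that[unfolded list_continuous_def] y(3) x] yR xs
        map_tuple_of[of xs] by simp
  qed simp
qed

text \<open>Lists of distinct entries off a finite set are dense, and limits are unique. The set
  \<open>A\<close> allows for formulas that are valid only away from a base point.\<close>

lemma list_continuous_eqI:
  assumes "list_continuous k G" "list_continuous k H" "finite A"
    and eq: "\<And>xs. length xs = k \<Longrightarrow> distinct xs \<Longrightarrow> set xs \<subseteq> R - A \<Longrightarrow> G xs = H xs"
    and "length xs = k" "set xs \<subseteq> R"
  shows "G xs = H xs"
proof -
  obtain ys where ys: "\<And>m. length (ys m) = k" "\<And>m. distinct (ys m)" "\<And>m. set (ys m) \<subseteq> R - A"
    "\<And>G. list_continuous k G \<Longrightarrow> (\<lambda>m. G (ys m)) \<longlonglongrightarrow> G xs"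
    using dense_lists[of A xs k] assms by blast
  have "G (ys m) = H (ys m)" for m
    by (intro eq ys)
  with ys(4)[OF assms(1)] ys(4)[OF assms(2)] show ?thesis
    by (simp add: LIMSEQ_unique)
qed

text \<open>Any member of a sequence approximating the zero list will do.\<close>

lemma distinct_list_avoiding:
  assumes "finite A"
  obtains xs where "length xs = k" "distinct xs" "set xs \<subseteq> R - A"
proof -
  have zero: "length (replicate k 0) = k" "set (replicate k 0) \<subseteq> R"
    by (auto simp: set_replicate_conv_if)
  obtain ys where ys: "\<And>m. length (ys m) = k" "\<And>m. distinct (ys m)" "\<And>m. set (ys m) \<subseteq> R - A"
    "\<And>G. list_continuous k G \<Longrightarrow> (\<lambda>m. G (ys m)) \<longlonglongrightarrow> G (replicate k 0)"
    using dense_lists[OF assms zero] by blast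
  show ?thesis
    using that[of "ys 0"] ys(1-3) by simp
qed

section \<open>Extended difference quotients as functions of lists\<close>

lemma Phi_extension_iff:
  "Phi_extension v k f g \<longleftrightarrow> continuous_on (R_pow v (Suc k)) g \<and>
    (\<forall>xs. length xs = Suc k \<longrightarrow> distinct xs \<longrightarrow> set xs \<subseteq> R \<longrightarrow> g (tuple_of xs) = ddiff f (set xs))"
proof -
  have "(\<forall>x\<in>nabla v (Suc k). g x = Phi k f x) \<longleftrightarrow>
    (\<forall>xs. length xs = Suc k \<longrightarrow> distinct xs \<longrightarrow> set xs \<subseteq> R \<longrightarrow> g (tuple_of xs) = ddiff f (set xs))"
  proof safe
    fix xs :: "'a list"
    assume *: "\<forall>x\<in>nabla v (Suc k). g x = Phi k f x" "length xs = Suc k" "distinct xs" "set xs \<subseteq> R"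
    then have "inj_on (tuple_of xs) {..<Suc k}" "tuple_of xs ` {..<Suc k} = set xs"
      using inj_on_tuple_of[of xs] image_tuple_of[of xs] by simp_all
    moreover from this have "tuple_of xs \<in> nabla v (Suc k)"
      using * tuple_of_in_R_pow[of xs v] by (simp add: nabla_def)
    ultimately show "g (tuple_of xs) = ddiff f (set xs)"
      using * by (simp add: Phi_eq_ddiff lessThan_Suc_atMost)
  next
    fix x
    assume *: "\<forall>xs. length xs = Suc k \<longrightarrow> distinct xs \<longrightarrow> set xs \<subseteq> R \<longrightarrow>
        g (tuple_of xs) = ddiff f (set xs)" and x: "x \<in> nabla v (Suc k)"
    define xs where "xs = map x [0..<Suc k]"
    have "set xs = x ` {..k}"
      by (simp add: xs_def atLeastLessThanSuc_atLeastAtMost atLeast0AtMost del: upt_Suc)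
    moreover have "distinct xs" "set xs \<subseteq> R" "tuple_of xs = x" "length xs = Suc k"
      unfolding xs_def using x tuple_of_map_upt[of x v "Suc k"]
        set_map_R_pow[of x v "Suc k" "[0..<Suc k]"]
      by (simp_all add: nabla_def distinct_map lessThan_atLeast0 del: upt_Suc)
    moreover have "inj_on x {..k}"
      using x by (simp add: nabla_def lessThan_Suc_atMost)
    ultimately show "g x = Phi k f x"
      using * by (metis Phi_eq_ddiff)
  qed
  then show ?thesis
    by (simp add: Phi_extension_def)
qed

lemma Phi_extension_Phi_ext: "f \<in> C_class v k \<Longrightarrow> Phi_extension v k f (Phi_ext v k f)"
  using someI_ex[of "Phi_extension v k f"] by (simp add: C_class_def Phi_ext_def)

lemma PhiL_ddiff:
  "f \<in> C_class v k \<Longrightarrow> length xs = Suc k \<Longrightarrow> distinct xs \<Longrightarrow> set xs \<subseteq> R \<Longrightarrow> PhiL f xs = ddiff f (set xs)"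
  using Phi_extension_Phi_ext[of f k] by (simp add: Phi_extension_iff PhiL_def)

text \<open>The arguments are a list of functions of \<open>z\<close>, so that repeated and constant
  entries are covered alike.\<close>

lemma tendsto_PhiL:
  fixes F :: "'b filter"
  assumes f: "f \<in> C_class v k" and gs: "length gs = Suc k"
    and lim: "\<And>g. g \<in> set gs \<Longrightarrow> (g \<longlongrightarrow> l g) F"
    and R: "\<And>g. g \<in> set gs \<Longrightarrow> eventually (\<lambda>z. g z \<in> R) F" "\<And>g. g \<in> set gs \<Longrightarrow> l g \<in> R"
  shows "((\<lambda>z. PhiL f (map (\<lambda>g. g z) gs)) \<longlongrightarrow> PhiL f (map l gs)) F"
proof -
  have "continuous_on (R_pow v (Suc k)) (Phi_ext v k f)"
    using Phi_extension_Phi_ext[OF f] by (simp add: Phi_extension_iff)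
  moreover have "((\<lambda>z. tuple_of (map (\<lambda>g. g z) gs)) \<longlongrightarrow> tuple_of (map l gs)) F"
    unfolding tendsto_product_componentwise by (simp add: tuple_of_def lim)
  moreover have "tuple_of (map l gs) \<in> R_pow v (Suc k)"
    using tuple_of_in_R_pow[of "map l gs" v] gs R(2) by auto
  moreover have "eventually (\<lambda>z. tuple_of (map (\<lambda>g. g z) gs) \<in> R_pow v (Suc k)) F"
  proof -
    have "eventually (\<lambda>z. \<forall>g\<in>set gs. g z \<in> R) F"
      using R(1) by (simp add: eventually_ball_finite)
    then show ?thesis
    proof eventually_elim
      case (elim z)
      then show ?case
        using tuple_of_in_R_pow[of "map (\<lambda>g. g z) gs" v] gs by auto
    qed
  qed
  ultimately show ?thesis
    using continuous_on_tendsto_compose[of "R_pow v (Suc k)" "Phi_ext v k f"] gs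
    by (simp add: PhiL_def)
qed

lemma continuous_on_PhiL:
  fixes S :: "'b::topological_space set"
  assumes f: "f \<in> C_class v k" and gs: "length gs = Suc k"
    and "\<And>g. g \<in> set gs \<Longrightarrow> continuous_on S g" "\<And>g z. g \<in> set gs \<Longrightarrow> z \<in> S \<Longrightarrow> g z \<in> R"
  shows "continuous_on S (\<lambda>z. PhiL f (map (\<lambda>g. g z) gs))"
  unfolding continuous_on_def
proof
  fix z assume z: "z \<in> S"
  have "eventually (\<lambda>w. w \<in> S) (at z within S)"
    by (simp add: eventually_at_filter)
  with z assms(3,4) show "((\<lambda>z. PhiL f (map (\<lambda>g. g z) gs)) \<longlongrightarrow> PhiL f (map (\<lambda>g. g z) gs)) (at z within S)"
    by (intro tendsto_PhiL[OF f gs]) (auto simp: continuous_on_def elim!: eventually_mono)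
qed

lemma continuous_on_PhiL_indices:
  assumes "f \<in> C_class v k" "length is = Suc k" "set is \<subseteq> {..<m}"
  shows "continuous_on (R_pow v m) (\<lambda>x. PhiL f (map x is))"
proof -
  have "continuous_on (R_pow v m) (\<lambda>x. PhiL f (map (\<lambda>g. g x) (map (\<lambda>i x. x i) is)))"
    using assms by (intro continuous_on_PhiL) (auto simp: R_pow_component subset_iff continuous_on_component)
  then show ?thesis
    by (simp add: comp_def)
qed

lemma list_continuous_PhiL: "f \<in> C_class v k \<Longrightarrow> list_continuous (Suc k) (PhiL f)"
  unfolding list_continuous_def by (rule continuous_on_PhiL_indices) auto

lemma C_classI:
  assumes "list_continuous (Suc k) G"
    and "\<And>xs. length xs = Suc k \<Longrightarrow> distinct xs \<Longrightarrow> set xs \<subseteq> R \<Longrightarrow> G xs = ddiff f (set xs)"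
  shows "f \<in> C_class v k"
proof -
  have "Phi_extension v k f (\<lambda>x. G (map x [0..<Suc k]))"
    unfolding Phi_extension_iff
  proof (intro conjI allI impI)
    show "continuous_on (R_pow v (Suc k)) (\<lambda>x. G (map x [0..<Suc k]))"
      using assms(1) by (simp add: list_continuous_def)
    fix xs :: "'a list"
    assume xs: "length xs = Suc k" "distinct xs" "set xs \<subseteq> R"
    then show "G (map (tuple_of xs) [0..<Suc k]) = ddiff f (set xs)"
      using assms(2)[OF xs] map_tuple_of[of xs] by (simp del: upt_Suc)
  qed
  then show ?thesis
    by (auto simp: C_class_def)
qed

text \<open>The means of identifying an extension: a continuous candidate that is correct at
  distinct arguments is the extension, by density.\<close>

lemma PhiL_unique:
  assumes "list_continuous (Suc k) G"
    and "\<And>xs. length xs = Suc k \<Longrightarrow> distinct xs \<Longrightarrow> set xs \<subseteq> R \<Longrightarrow> G xs = ddiff f (set xs)"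
    and "length xs = Suc k" "set xs \<subseteq> R"
  shows "PhiL f xs = G xs"
proof -
  have f: "f \<in> C_class v k"
    using assms(1,2) by (rule C_classI)
  show ?thesis
  proof (rule list_continuous_eqI[of "Suc k" _ _ "{}"])
    fix xs :: "'a list" assume "length xs = Suc k" "distinct xs" "set xs \<subseteq> R - {}"
    then show "PhiL f xs = G xs"
      using PhiL_ddiff[OF f] assms(2) by simp
  qed (use assms f list_continuous_PhiL in auto)
qed

lemma PhiL_single: "f \<in> C_class v 0 \<Longrightarrow> x \<in> R \<Longrightarrow> PhiL f [x] = f x"
  by (subst PhiL_ddiff[of f 0]) auto

lemma D_op_eq_PhiL: "D_op v j f x = PhiL f (replicate (Suc j) x)"
  by (simp add: D_op_def PhiL_def tuple_of_replicate del: replicate_Suc)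

text \<open>Permuting the arguments first gives another continuous function with the same values at
  distinct arguments, because \<open>ddiff\<close> depends on the set alone; uniqueness of the
  extension finishes.\<close>

lemma PhiL_perm:
  assumes f: "f \<in> C_class v k" and len: "length xs = Suc k" and R: "set xs \<subseteq> R" and ys: "mset xs = mset ys"
  shows "PhiL f xs = PhiL f ys"
proof -
  have len_ys: "length ys = Suc k"
    using len ys mset_eq_length by metis
  obtain p where p: "p permutes {..<length ys}" "permute_list p ys = xs"
    using mset_eq_permutation[OF ys] by blast
  have "list_continuous (Suc k) (\<lambda>ys. PhiL f (permute_list p ys))"
  proof -
    have "permute_list p (map x [0..<Suc k]) = map x (map p [0..<Suc k])" for x :: "nat \<Rightarrow> 'a"
      using p len_ys permutes_in_image[OF p(1)]
      by (auto simp: permute_list_def simp del: upt_Suc)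
    moreover have "continuous_on (R_pow v (Suc k)) (\<lambda>x. PhiL f (map x (map p [0..<Suc k])))"
    proof (rule continuous_on_PhiL_indices[OF f])
      show "set (map p [0..<Suc k]) \<subseteq> {..<Suc k}"
        using permutes_image[OF p(1)] len_ys by (simp add: lessThan_atLeast0 del: upt_Suc)
    qed simp
    ultimately show ?thesis
      unfolding list_continuous_def by simp
  qed
  then have "PhiL f ys = PhiL f (permute_list p ys)"
  proof (rule PhiL_unique)
    fix zs :: "'a list" assume zs: "length zs = Suc k" "distinct zs" "set zs \<subseteq> R"
    then have "p permutes {..<length zs}"
      using p len_ys by simp
    then have "distinct (permute_list p zs)" "set (permute_list p zs) = set zs"
      by (simp_all add: zs)
    with zs show "PhiL f (permute_list p zs) = ddiff f (set zs)"
      by (subst PhiL_ddiff[OF f]) auto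
  next
    show "length ys = Suc k" "set ys \<subseteq> R"
      using len_ys R ys by (auto dest: mset_eq_setD)
  qed
  with p show ?thesis
    by simp
qed

section \<open>Nesting of the classes and the extended recursion\<close>

lemma C_class_Suc:
  assumes f: "f \<in> C_class v (Suc k)"
  shows "f \<in> C_class v k"
proof -
  \<comment> \<open>Replacing the entries of \<open>xs\<close> one by one by those of a base point \<open>a\<close> expresses \<open>\<Phi>\<^sub>k f\<close> through
    \<open>\<Phi>\<^sub>k\<^sub>+\<^sub>1 f\<close>. The outcome is independent of \<open>a\<close>, so \<open>a\<close> may be moved away from any given \<open>xs\<close>.\<close>
  define G where "G a xs = ddiff f (set a) +
    (\<Sum>i\<le>k. (xs ! i - a ! i) * PhiL f (take (Suc i) a @ drop i xs))" for a xs
  have ddiff_G: "G a xs = ddiff f (set xs)"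
    if "length a = Suc k" "length xs = Suc k" "distinct (a @ xs)" "set a \<subseteq> R" "set xs \<subseteq> R" for a xs
  proof -
    have "(xs ! i - a ! i) * PhiL f (take (Suc i) a @ drop i xs) =
        ddiff f (set (take i a @ drop i xs)) - ddiff f (set (take (Suc i) a @ drop (Suc i) xs))"
      if "i \<le> k" for i
    proof -
      define S where "S = set (take i a) \<union> set (drop (Suc i) xs)"
      have xs: "drop i xs = xs ! i # drop (Suc i) xs"
        using \<open>i \<le> k\<close> \<open>length xs = Suc k\<close> by (simp add: Cons_nth_drop_Suc)
      have a: "take (Suc i) a = take i a @ [a ! i]"
        using \<open>i \<le> k\<close> \<open>length a = Suc k\<close> by (simp add: take_Suc_conv_app_nth)
      have dist: "distinct (take (Suc i) a @ drop i xs)"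
        using \<open>distinct (a @ xs)\<close>
        by (auto dest: in_set_takeD in_set_dropD)
      have "PhiL f (take (Suc i) a @ drop i xs) = ddiff f (set (take (Suc i) a @ drop i xs))"
        using dist that \<open>i \<le> k\<close> \<open>set a \<subseteq> R\<close> \<open>set xs \<subseteq> R\<close> \<open>length a = Suc k\<close> \<open>length xs = Suc k\<close>
        by (intro PhiL_ddiff[OF f]) (auto dest: in_set_takeD in_set_dropD)
      moreover have "set (take (Suc i) a @ drop i xs) = insert (xs ! i) (insert (a ! i) S)"
        "set (take i a @ drop i xs) = insert (xs ! i) S"
        "set (take (Suc i) a @ drop (Suc i) xs) = insert (a ! i) S"
        by (auto simp: xs a S_def)
      moreover have "xs ! i \<notin> S" "a ! i \<notin> S" "xs ! i \<noteq> a ! i"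
        using dist unfolding xs a S_def by auto
      ultimately show ?thesis
        using ddiff_rec[of S "xs ! i" "a ! i" f] by (simp add: S_def)
    qed
    then have "(\<Sum>i\<le>k. (xs ! i - a ! i) * PhiL f (take (Suc i) a @ drop i xs)) =
        (\<Sum>i<Suc k. ddiff f (set (take i a @ drop i xs)) - ddiff f (set (take (Suc i) a @ drop (Suc i) xs)))"
      by (simp add: lessThan_Suc_atMost)
    also have "\<dots> = ddiff f (set xs) - ddiff f (set a)"
      using that sum_lessThan_telescope'[of "\<lambda>i. ddiff f (set (take i a @ drop i xs))" "Suc k"] by simp
    finally show ?thesis
      by (simp add: G_def)
  qed
  have cont: "list_continuous (Suc k) (G a)" if a: "length a = Suc k" "set a \<subseteq> R" for a
    unfolding list_continuous_def G_def
  proof (intro continuous_on_add_lf continuous_on_sum_lf continuous_on_mult_lf continuous_on_diff_lf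
      continuous_on_const)
    fix i assume i: "i \<in> {..k}"
    then show "continuous_on (R_pow v (Suc k)) (\<lambda>x. map x [0..<Suc k] ! i)"
      by (simp add: continuous_on_component del: upt_Suc)
    define gs where "gs = map (\<lambda>c (x :: nat \<Rightarrow> 'a). c) (take (Suc i) a) @ map (\<lambda>j x. x j) (drop i [0..<Suc k])"
    have "continuous_on (R_pow v (Suc k)) (\<lambda>x. PhiL f (map (\<lambda>g. g x) gs))"
      using a i unfolding gs_def
      by (intro continuous_on_PhiL[OF f])
        (auto simp: continuous_on_component R_pow_component simp del: upt_Suc dest!: in_set_takeD in_set_dropD)
    then show "continuous_on (R_pow v (Suc k)) (\<lambda>x. PhiL f (take (Suc i) a @ drop i (map x [0..<Suc k])))"
      by (simp add: gs_def comp_def drop_map del: upt_Suc)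
  qed
  have indep: "G a xs = G b xs"
    if "length a = Suc k" "length b = Suc k" "distinct a" "distinct b" "set a \<subseteq> R" "set b \<subseteq> R"
      "length xs = Suc k" "set xs \<subseteq> R" for a b xs
  proof (rule list_continuous_eqI[of "Suc k" "G a" "G b" "set a \<union> set b"])
    fix ys :: "'a list" assume ys: "length ys = Suc k" "distinct ys" "set ys \<subseteq> R - (set a \<union> set b)"
    then have "G a ys = ddiff f (set ys)" "G b ys = ddiff f (set ys)"
      using that by (auto intro!: ddiff_G)
    then show "G a ys = G b ys"
      by simp
  qed (use that cont in auto)
  obtain a where a: "length a = Suc k" "distinct a" "set a \<subseteq> R - {}"
    using distinct_list_avoiding[of "{}"] by blast
  show ?thesis
  proof (rule C_classI)
    show "list_continuous (Suc k) (G a)"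
      using a by (intro cont) auto
  next
    fix xs :: "'a list" assume xs: "length xs = Suc k" "distinct xs" "set xs \<subseteq> R"
    obtain b where b: "length b = Suc k" "distinct b" "set b \<subseteq> R - set xs"
      using distinct_list_avoiding[of "set xs"] by blast
    have "G a xs = G b xs"
      using a b xs by (intro indep) auto
    also have "\<dots> = ddiff f (set xs)"
      using b xs by (intro ddiff_G) auto
    finally show "G a xs = ddiff f (set xs)" .
  qed
qed

lemma C_class_mono: "f \<in> C_class v n \<Longrightarrow> k \<le> n \<Longrightarrow> f \<in> C_class v k"
  by (induction n rule: nat_induct) (auto simp: le_Suc_eq dest: C_class_Suc)

text \<open>Both sides are continuous in all arguments and agree at distinct ones by
  \<open>ddiff_rec\<close>. In this product form the identity makes sense for \<open>a = b\<close>
  too.\<close>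

lemma PhiL_rec:
  assumes f: "f \<in> C_class v n" and n: "length xs < n" and R: "a \<in> R" "b \<in> R" "set xs \<subseteq> R"
  shows "(a - b) * PhiL f (a # b # xs) = PhiL f (a # xs) - PhiL f (b # xs)"
proof -
  define k where "k = length xs"
  have f1: "f \<in> C_class v (Suc k)"
    using f n by (auto simp: k_def intro: C_class_mono)
  have f0: "f \<in> C_class v k"
    using f1 by (rule C_class_Suc)
  define G where "G ys = (ys ! 0 - ys ! 1) * PhiL f ys" for ys
  define H where "H ys = PhiL f (ys ! 0 # drop 2 ys) - PhiL f (ys ! 1 # drop 2 ys)" for ys
  have "G (a # b # xs) = H (a # b # xs)"
  proof (rule list_continuous_eqI[of "Suc (Suc k)" G H "{}"])
    show "list_continuous (Suc (Suc k)) G"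
      unfolding list_continuous_def G_def
      by (intro continuous_on_mult_lf continuous_on_diff_lf
          list_continuous_PhiL[OF f1, unfolded list_continuous_def])
        (simp_all add: continuous_on_component del: upt_Suc)
    have *: "PhiL f (map x [0..<Suc (Suc k)] ! i # drop 2 (map x [0..<Suc (Suc k)])) =
       PhiL f (map x (i # [2..<Suc (Suc k)]))" if "i < 2" for i x
      using that by (simp add: drop_map numeral_2_eq_2 del: upt_Suc)
    show "list_continuous (Suc (Suc k)) H"
      unfolding list_continuous_def H_def
      by (subst *, simp)+
        (intro continuous_on_diff_lf continuous_on_PhiL_indices[OF f0]; auto simp del: upt_Suc)
  next
    fix ys :: "'a list"
    assume ys: "length ys = Suc (Suc k)" "distinct ys" "set ys \<subseteq> R - {}"
    then obtain c d zs where zs: "ys = c # d # zs"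
      by (metis length_Suc_conv)
    then show "G ys = H ys"
      using ys ddiff_rec[of "set zs" c d f]
      by (simp add: G_def H_def PhiL_ddiff[OF f1] PhiL_ddiff[OF f0] numeral_2_eq_2)
  qed (use R in \<open>auto simp: k_def\<close>)
  then show ?thesis
    by (simp add: G_def H_def numeral_2_eq_2)
qed

end

section \<open>Difference quotients of \<open>D\<^sub>j f\<close>\<close>

text \<open>
  \<open>spread G j A [x\<^sub>0, \<dots>, x\<^sub>i]\<close> is the sum, over all \<open>\<alpha>\<close> with \<open>\<alpha>\<^sub>0 + \<dots> + \<alpha>\<^sub>i = j\<close>, of the values of \<open>G\<close> at \<open>A\<close>
  together with \<open>1 + \<alpha>\<^sub>k\<close> copies of each \<open>x\<^sub>k\<close>. When \<open>G\<close> is the extension of the difference quotients of \<open>f\<close>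
  and \<open>A\<close> is empty, this is \<open>\<Phi>\<^sub>i (D\<^sub>j f)\<close> at \<open>(x\<^sub>0, \<dots>, x\<^sub>i)\<close>.
\<close>

primrec spread :: "('a multiset \<Rightarrow> 'b::comm_monoid_add) \<Rightarrow> nat \<Rightarrow> 'a multiset \<Rightarrow> 'a list \<Rightarrow> 'b" where
  "spread G j A [] = (if j = 0 then G A else 0)"
| "spread G j A (x # xs) = (\<Sum>s\<le>j. spread G (j - s) (A + replicate_mset (Suc s) x) xs)"

lemma spread_single: "spread G j A [x] = G (A + replicate_mset (Suc j) x)"
proof -
  have "spread G j A [x] = (\<Sum>s\<le>j. if s = j then G (A + replicate_mset (Suc j) x) else 0)"
    by (auto intro!: sum.cong)
  then show ?thesis
    by simp
qed

text \<open>All summands coincide, and their number is that of the ways to write \<open>j\<close> as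
  an ordered sum of \<open>l + 1\<close> naturals. The count follows by the hockey-stick identity;
  the \<open>c\<close> copies already accumulated keep the induction going.\<close>

lemma spread_replicate:
  "spread G j (replicate_mset c y) (replicate (Suc l) y) =
    (of_nat (j + l choose l) :: 'b::semiring_1) * G (replicate_mset (c + j + Suc l) y)"
proof (induction l arbitrary: j c)
  case 0
  have "replicate_mset c y + replicate_mset (Suc j) y = replicate_mset (c + Suc j) y"
    by (rule multiset_eqI) simp
  then show ?case
    using spread_single[of G j "replicate_mset c y" y] by simp
next
  case (Suc l)
  have "spread G j (replicate_mset c y) (replicate (Suc (Suc l)) y) =
      (\<Sum>s\<le>j. spread G (j - s) (replicate_mset (c + Suc s) y) (replicate (Suc l) y))"
  proof -
    have "replicate_mset c y + replicate_mset (Suc s) y = replicate_mset (c + Suc s) y" for s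
      by (rule multiset_eqI) simp
    then show ?thesis
      by (subst replicate_Suc, subst spread.simps(2)) (simp only:)
  qed
  also have "\<dots> = (\<Sum>s\<le>j. of_nat (j - s + l choose l) * G (replicate_mset (c + j + Suc (Suc l)) y))"
    by (intro sum.cong) (auto simp only: Suc.IH, simp add: algebra_simps)
  also have "\<dots> = of_nat (\<Sum>s\<le>j. j - s + l choose l) * G (replicate_mset (c + j + Suc (Suc l)) y)"
    by (simp add: sum_distrib_right)
  also have "(\<Sum>s\<le>j. j - s + l choose l) = (\<Sum>s\<le>j. l + s choose l)"
    by (rule sum.reindex_bij_witness[of _ "\<lambda>s. j - s" "\<lambda>s. j - s"]) (auto simp: add.commute)
  also have "\<dots> = (j + Suc l choose Suc l)"
    by (subst choose_rising_sum(1)) (simp add: add.commute[of l])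
  finally show ?case .
qed

context
  fixes G :: "'a::field multiset \<Rightarrow> 'a" and U :: "'a set" and n :: nat
  assumes G_rec: "\<And>a b A. a \<in> U \<Longrightarrow> b \<in> U \<Longrightarrow> set_mset A \<subseteq> U \<Longrightarrow> size A < n \<Longrightarrow>
    (a - b) * G (add_mset a (add_mset b A)) = G (add_mset a A) - G (add_mset b A)"
begin

text \<open>The recursion of \<open>G\<close> holds in each summand, with \<open>a\<close> and
  \<open>b\<close> inside the accumulator. The size bound ensures that \<open>G\<close> meets at
  most \<open>n + 1\<close> arguments.\<close>

lemma spread_rec_base:
  assumes "a \<in> U" "b \<in> U"
  shows "set_mset A \<subseteq> U \<Longrightarrow> set xs \<subseteq> U \<Longrightarrow> size A + j + length xs < n \<Longrightarrow>
    (a - b) * spread G j (add_mset a (add_mset b A)) xs =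
      spread G j (add_mset a A) xs - spread G j (add_mset b A) xs"
proof (induction xs arbitrary: j A)
  case Nil
  with assms G_rec show ?case
    by simp
next
  case (Cons x xs)
  have "(a - b) * spread G (j - s) (add_mset a (add_mset b (A + replicate_mset (Suc s) x))) xs =
      spread G (j - s) (add_mset a (A + replicate_mset (Suc s) x)) xs -
      spread G (j - s) (add_mset b (A + replicate_mset (Suc s) x)) xs" if "s \<le> j" for s
    using Cons.prems that by (intro Cons.IH) (auto simp: subset_iff)
  then show ?case
    by (simp add: sum_distrib_left sum_subtractf del: replicate_mset_Suc)
qed

text \<open>Sort the terms by the number \<open>u\<close> of extra copies shared by \<open>a\<close>
  and \<open>b\<close>. For fixed \<open>u\<close> the recursion of \<open>G\<close> makes the sum
  over the copies of \<open>a\<close> telescope, and the two ends carry copies of \<open>a\<close>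
  only or of \<open>b\<close> only.\<close>

lemma spread_rec:
  assumes "a \<in> U" "b \<in> U" "set_mset A \<subseteq> U" "set xs \<subseteq> U" "size A + j + length xs < n"
  shows "(a - b) * spread G j A (a # b # xs) = spread G j A (a # xs) - spread G j A (b # xs)"
proof -
  \<comment> \<open>Here \<open>s\<close> and \<open>t\<close> count all copies of \<open>a\<close>
    and \<open>b\<close>, while \<open>u\<close> is the part of \<open>j\<close> used up by
    them.\<close>
  define V where "V u s t = spread G (j - u) (A + replicate_mset s a + replicate_mset t b) xs" for u s t
  have step: "(a - b) * V u (Suc s) (Suc (u - s)) = V u (Suc s) (Suc u - Suc s) - V u s (Suc u - s)"
    if "s \<le> u" "u \<le> j" for u s
  proof -
    define B where "B = A + replicate_mset s a + replicate_mset (u - s) b"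
    have "set_mset B \<subseteq> U" "size B + (j - u) + length xs < n"
      using that assms unfolding B_def by (auto split: if_splits)
    then have "(a - b) * spread G (j - u) (add_mset a (add_mset b B)) xs =
        spread G (j - u) (add_mset a B) xs - spread G (j - u) (add_mset b B) xs"
      using assms by (intro spread_rec_base)
    then show ?thesis
      using that by (simp add: V_def B_def Suc_diff_le add_mset_commute)
  qed
  have "spread G j A (a # b # xs) = (\<Sum>s\<le>j. \<Sum>t\<le>j - s. V (s + t) (Suc s) (Suc t))"
    by (simp add: V_def del: replicate_mset_Suc)
  also have "\<dots> = (\<Sum>(s, t)\<in>{(s, t). s + t \<le> j}. V (s + t) (Suc s) (Suc t))"
  proof -
    have "{(s, t). s + t \<le> j} = (SIGMA s:{..j}. {..j - s})"
      by auto
    then show ?thesis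
      by (simp add: sum.Sigma)
  qed
  also have "\<dots> = (\<Sum>u\<le>j. \<Sum>s\<le>u. V u (Suc s) (Suc (u - s)))"
    by (subst sum.triangle_reindex_eq) simp
  finally have "(a - b) * spread G j A (a # b # xs) =
      (\<Sum>u\<le>j. \<Sum>s<Suc u. (a - b) * V u (Suc s) (Suc (u - s)))"
    by (simp add: sum_distrib_left lessThan_Suc_atMost)
  also have "\<dots> = (\<Sum>u\<le>j. \<Sum>s<Suc u. V u (Suc s) (Suc u - Suc s) - V u s (Suc u - s))"
    by (intro sum.cong) (auto simp: step)
  also have "\<dots> = (\<Sum>u\<le>j. V u (Suc u) 0 - V u 0 (Suc u))"
    by (intro sum.cong refl, subst sum_lessThan_telescope) simp
  also have "\<dots> = spread G j A (a # xs) - spread G j A (b # xs)"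
    by (simp add: V_def sum_subtractf del: replicate_mset_Suc)
  finally show ?thesis .
qed

text \<open>Both sides satisfy the divided difference recursion and agree on singletons; for
  distinct \<open>a\<close> and \<open>b\<close> the factor \<open>a - b\<close> cancels.\<close>

lemma ddiff_spread:
  assumes "xs \<noteq> []" "distinct xs" "set xs \<subseteq> U" "length xs + j \<le> Suc n"
  shows "ddiff (\<lambda>x. G (replicate_mset (Suc j) x)) (set xs) = spread G j {#} xs"
  using assms
proof (induction "length xs" arbitrary: xs rule: less_induct)
  case less
  consider x where "xs = [x]" | a b ys where "xs = a # b # ys"
    using less.prems(1) by (metis list.exhaust)
  then show ?case
  proof cases
    case 1
    then show ?thesis
      using spread_single[of G j "{#}" x] by simp
  next
    case 2
    define h where "h = (\<lambda>x. G (replicate_mset (Suc j) x))"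
    have "(a - b) * ddiff h (set xs) = ddiff h (set (a # ys)) - ddiff h (set (b # ys))"
      using ddiff_rec[of "set ys" a b h] 2 less.prems by simp
    also have "\<dots> = spread G j {#} (a # ys) - spread G j {#} (b # ys)"
      unfolding h_def using 2 less.prems by (subst (1 2) less.hyps) auto
    also have "\<dots> = (a - b) * spread G j {#} (a # b # ys)"
      using 2 less.prems by (subst spread_rec) auto
    finally show ?thesis
      using 2 less.prems by (auto simp only: h_def mult_cancel_left) auto
  qed
qed

end

section \<open>The quotients of \<open>D_op v j f\<close> as sums of quotients of f\<close>

context local_field
begin

text \<open>By \<open>PhiL_perm\<close> the chosen enumeration of the multiset does not matter
  within the orders where f is differentiable.\<close>

definition PhiM :: "('a \<Rightarrow> 'a) \<Rightarrow> 'a multiset \<Rightarrow> 'a" where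
  "PhiM f M = PhiL f (SOME xs. mset xs = M)"

lemma PhiM_mset:
  assumes "f \<in> C_class v n" "xs \<noteq> []" "length xs \<le> Suc n" "set xs \<subseteq> R"
  shows "PhiM f (mset xs) = PhiL f xs"
proof -
  define ys where "ys = (SOME ys. mset ys = mset xs)"
  have "mset ys = mset xs"
    unfolding ys_def by (rule someI) (rule refl)
  moreover have "f \<in> C_class v (length xs - 1)"
    using assms by (intro C_class_mono[OF assms(1)]) auto
  ultimately have "PhiL f xs = PhiL f ys"
    using assms by (intro PhiL_perm) (auto simp: Suc_diff_le Suc_le_eq)
  then show ?thesis
    by (simp add: PhiM_def ys_def)
qed

lemma PhiM_replicate:
  "f \<in> C_class v n \<Longrightarrow> j \<le> n \<Longrightarrow> x \<in> R \<Longrightarrow> PhiM f (replicate_mset (Suc j) x) = D_op v j f x"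
  using PhiM_mset[of f n "replicate (Suc j) x"]
  by (auto simp: D_op_eq_PhiL mset_replicate simp del: replicate_Suc replicate_mset_Suc)

lemma PhiM_rec:
  assumes f: "f \<in> C_class v n" and "a \<in> R" "b \<in> R" "set_mset A \<subseteq> R" "size A < n"
  shows "(a - b) * PhiM f (add_mset a (add_mset b A)) = PhiM f (add_mset a A) - PhiM f (add_mset b A)"
proof -
  obtain xs where xs: "mset xs = A"
    using ex_mset by blast
  have *: "PhiM f (mset ys) = PhiL f ys" if "ys \<in> {a # b # xs, a # xs, b # xs}" for ys
    using that assms xs by (intro PhiM_mset[OF f]) auto
  have "(a - b) * PhiL f (a # b # xs) = PhiL f (a # xs) - PhiL f (b # xs)"
    using assms xs by (intro PhiL_rec[OF f]) auto
  then show ?thesis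
    using *[of "a # b # xs"] *[of "a # xs"] *[of "b # xs"] xs by simp
qed

text \<open>The accumulator is given by a list \<open>js\<close> of coordinate indices, so that it
  may grow during the induction and still vary continuously with \<open>x\<close>.\<close>

lemma continuous_on_spread:
  assumes f: "f \<in> C_class v n"
  shows "js @ is \<noteq> [] \<Longrightarrow> length js + j + length is \<le> Suc n \<Longrightarrow> set js \<subseteq> {..<m} \<Longrightarrow> set is \<subseteq> {..<m} \<Longrightarrow>
    continuous_on (R_pow v m) (\<lambda>x. spread (PhiM f) j (mset (map x js)) (map x is))"
proof (induction "is" arbitrary: j js)
  case Nil
  have "continuous_on (R_pow v m) (\<lambda>x. PhiM f (mset (map x js)))"
  proof (rule continuous_on_eq)
    show "continuous_on (R_pow v m) (\<lambda>x. PhiL f (map x js))"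
      using Nil by (intro continuous_on_PhiL_indices[OF C_class_mono[OF f, of "length js - 1"]])
        (auto simp: Suc_le_eq)
    show "PhiL f (map x js) = PhiM f (mset (map x js))" if "x \<in> R_pow v m" for x
      using Nil that by (intro PhiM_mset[OF f, symmetric] set_map_R_pow) auto
  qed
  then show ?case
    by (cases "j = 0") (simp_all add: continuous_on_const)
next
  case (Cons i "is")
  have "continuous_on (R_pow v m)
      (\<lambda>x. spread (PhiM f) (j - s) (mset (map x (js @ replicate (Suc s) i))) (map x is))"
    if "s \<le> j" for s
    using Cons.prems that by (intro Cons.IH) auto
  then have "continuous_on (R_pow v m)
      (\<lambda>x. spread (PhiM f) (j - s) (mset (map x js) + replicate_mset (Suc s) (x i)) (map x is))"
    if "s \<le> j" for s
    using that by (simp add: mset_replicate[symmetric] map_replicate del: mset_replicate replicate_Suc)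
  then show ?case
    by (auto intro!: continuous_on_sum_lf simp del: replicate_mset_Suc)
qed

lemma list_continuous_spread:
  assumes "f \<in> C_class v n" "i + j \<le> n"
  shows "list_continuous (Suc i) (spread (PhiM f) j {#})"
  unfolding list_continuous_def
  using continuous_on_spread[OF assms(1), of "[]" "[0..<Suc i]" j "Suc i"] assms(2)
  by (simp add: lessThan_atLeast0 del: upt_Suc)

lemma ddiff_D_op:
  assumes f: "f \<in> C_class v n" and "length xs = Suc i" "distinct xs" "set xs \<subseteq> R" "i + j \<le> n"
  shows "spread (PhiM f) j {#} xs = ddiff (D_op v j f) (set xs)"
proof -
  have "spread (PhiM f) j {#} xs = ddiff (\<lambda>x. PhiM f (replicate_mset (Suc j) x)) (set xs)"
    using assms by (intro ddiff_spread[of R n, symmetric] PhiM_rec[OF f]) auto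
  also have "\<dots> = ddiff (D_op v j f) (set xs)"
    using assms by (intro ddiff_cong PhiM_replicate[OF f]) auto
  finally show ?thesis .
qed

text \<open>The function \<open>spread (PhiM f) j {#}\<close> is the required continuous
  extension.\<close>

lemma C_class_D_op:
  assumes f: "f \<in> C_class v n" and "i + j \<le> n"
  shows "D_op v j f \<in> C_class v i"
  using assms by (intro C_classI[OF list_continuous_spread[OF f] ddiff_D_op[OF f]]) auto

lemma PhiL_D_op:
  assumes f: "f \<in> C_class v n" and "i + j \<le> n" "length xs = Suc i" "set xs \<subseteq> R"
  shows "PhiL (D_op v j f) xs = spread (PhiM f) j {#} xs"
  using assms by (intro PhiL_unique[OF list_continuous_spread[OF f] ddiff_D_op[OF f]]) auto

text \<open>The composition law of Hasse derivatives: at a constant list all summands of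
  \<open>spread\<close> are equal, and \<open>spread_replicate\<close> counts them.\<close>

lemma D_op_D_op:
  assumes f: "f \<in> C_class v n" and "i + j \<le> n" "x \<in> R"
  shows "D_op v i (D_op v j f) x = of_nat (i + j choose i) * D_op v (i + j) f x"
proof -
  have "D_op v i (D_op v j f) x = spread (PhiM f) j (replicate_mset 0 x) (replicate (Suc i) x)"
    unfolding D_op_eq_PhiL[of i] using assms by (subst PhiL_D_op[OF f]) auto
  also have "\<dots> = of_nat (i + j choose i) * PhiM f (replicate_mset (Suc (i + j)) x)"
    by (subst spread_replicate) (simp add: add.commute)
  also have "PhiM f (replicate_mset (Suc (i + j)) x) = D_op v (i + j) f x"
    using assms by (intro PhiM_replicate[OF f]) auto
  finally show ?thesis .
qed

text \<open>By the ultrametric inequality the number of summands is irrelevant; each evaluates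
  \<open>G\<close> at exactly \<open>k\<close> arguments.\<close>

lemma absval_spread_le:
  assumes G: "\<And>M. size M = k \<Longrightarrow> set_mset M \<subseteq> R \<Longrightarrow> N (G M) \<le> B" and B: "0 \<le> B"
  shows "set xs \<subseteq> R \<Longrightarrow> set_mset A \<subseteq> R \<Longrightarrow> size A + j + length xs = k \<Longrightarrow> N (spread G j A xs) \<le> B"
proof (induction xs arbitrary: j A)
  case Nil
  with G B show ?case
    by simp
next
  case (Cons x xs)
  show ?case
    unfolding spread.simps
    using Cons.prems B by (intro absval_sum_le Cons.IH) (auto simp: subset_iff)
qed

text \<open>Since \<open>D_op v j h y\<close> is the quotient at \<open>j + 1\<close> copies of
  \<open>y\<close>, subtracting the next Taylor term leaves a difference of two quotients in which
  only \<open>x\<close> is exchanged for \<open>y\<close>; \<open>PhiL_rec\<close> extracts another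
  factor \<open>x - y\<close>.\<close>

lemma taylor_remainder:
  assumes h: "h \<in> C_class v m" and x: "x \<in> R" and y: "y \<in> R"
  shows "j \<le> m \<Longrightarrow> h x - (\<Sum>l<j. (x - y) ^ l * D_op v l h y) =
    (x - y) ^ j * PhiL h (x # replicate j y)"
proof (induction j)
  case 0
  have "h \<in> C_class v 0"
    using C_class_mono[OF h] by simp
  then show ?case
    using PhiL_single x by simp
next
  case (Suc j)
  then have "h x - (\<Sum>l<Suc j. (x - y) ^ l * D_op v l h y) =
      (x - y) ^ j * (PhiL h (x # replicate j y) - PhiL h (y # replicate j y))"
    by (simp add: D_op_eq_PhiL algebra_simps)
  also have "\<dots> = (x - y) ^ j * ((x - y) * PhiL h (x # y # replicate j y))"
    using Suc.prems x y by (subst PhiL_rec[OF h]) (auto simp: subset_iff)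
  finally show ?case
    by (simp add: algebra_simps)
qed

lemma psi_eq_PhiL:
  assumes h: "h \<in> C_class v m" and x: "x \<in> R" and y: "y \<in> R" and "x \<noteq> y" "j < m"
  shows "psi v j h x y = PhiL h (x # replicate (Suc j) y)"
proof -
  have "h \<in> C_class v 0"
    using C_class_mono[OF h] by simp
  then have D0: "D_op v 0 h y = h y"
    using PhiL_single y by (simp add: D_op_eq_PhiL)
  have "{..<Suc j} = insert 0 {1..j}"
    by auto
  then have "h x - h y - (\<Sum>l=1..j. (x - y) ^ l * D_op v l h y) =
      h x - (\<Sum>l<Suc j. (x - y) ^ l * D_op v l h y)"
    by (simp add: D0 del: sum.lessThan_Suc)
  also have "\<dots> = (x - y) ^ Suc j * PhiL h (x # replicate (Suc j) y)"
    using assms by (intro taylor_remainder[OF h]) auto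
  finally show ?thesis
    using \<open>x \<noteq> y\<close> by (simp add: psi_def)
qed

section \<open>Cut-off monomials and Taylor polynomials\<close>

text \<open>Every value of the extension is a limit of divided differences over sets of distinct
  points, and the bound survives the limit.\<close>

lemma PhiL_le:
  assumes f: "f \<in> C_class v k"
    and B: "\<And>S. finite S \<Longrightarrow> S \<subseteq> R \<Longrightarrow> card S = Suc k \<Longrightarrow> N (ddiff f S) \<le> B"
    and xs: "length xs = Suc k" "set xs \<subseteq> R"
  shows "N (PhiL f xs) \<le> B"
proof -
  obtain ys where ys: "\<And>m. length (ys m) = Suc k" "\<And>m. distinct (ys m)" "\<And>m. set (ys m) \<subseteq> R - {}"
    "\<And>G. list_continuous (Suc k) G \<Longrightarrow> (\<lambda>m. G (ys m)) \<longlonglongrightarrow> G xs"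
    using dense_lists[of "{}" xs "Suc k"] xs by blast
  have "PhiL f (ys m) = ddiff f (set (ys m))" for m
    using ys by (intro PhiL_ddiff[OF f]) auto
  moreover have "N (ddiff f (set (ys m))) \<le> B" for m
    using ys distinct_card[of "ys m"] by (intro B) auto
  moreover have "(\<lambda>m. N (PhiL f (ys m))) \<longlonglongrightarrow> N (PhiL f xs)"
    using ys list_continuous_PhiL[OF f] by (intro tendsto_absval) auto
  ultimately show ?thesis
    by (intro LIMSEQ_le_const2) auto
qed

lemma norm_C_le_iff:
  "norm_C v n f \<le> ereal B \<longleftrightarrow>
    (\<forall>j xs. j \<le> n \<longrightarrow> length xs = Suc j \<longrightarrow> set xs \<subseteq> R \<longrightarrow> N (PhiL f xs) \<le> B)" (is "_ \<longleftrightarrow> ?rhs")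
proof -
  have "(\<forall>x\<in>R_pow v (Suc j). N (Phi_ext v j f x) \<le> B) \<longleftrightarrow>
      (\<forall>xs. length xs = Suc j \<longrightarrow> set xs \<subseteq> R \<longrightarrow> N (PhiL f xs) \<le> B)" for j
  proof (intro iffI ballI allI impI)
    fix xs assume "\<forall>x\<in>R_pow v (Suc j). N (Phi_ext v j f x) \<le> B" "length xs = Suc j" "set xs \<subseteq> R"
    then show "N (PhiL f xs) \<le> B"
      using tuple_of_in_R_pow[of xs v] by (simp add: PhiL_def)
  next
    fix x assume *: "\<forall>xs. length xs = Suc j \<longrightarrow> set xs \<subseteq> R \<longrightarrow> N (PhiL f xs) \<le> B" "x \<in> R_pow v (Suc j)"
    then have "N (PhiL f (map x [0..<Suc j])) \<le> B"
      using set_map_R_pow[of x v "Suc j" "[0..<Suc j]"] by (simp add: lessThan_atLeast0 del: upt_Suc)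
    then show "N (Phi_ext v j f x) \<le> B"
      using tuple_of_map_upt[OF *(2)] by (simp add: PhiL_def del: upt_Suc)
  qed
  then show ?thesis
    by (simp add: norm_C_def SUP_le_iff) auto
qed

section \<open>Limits of divided differences and bounds for cut-off monomials\<close>

lemma ddiff_tendsto:
  fixes g :: "nat \<Rightarrow> 'a \<Rightarrow> 'a"
  assumes "finite S" "\<And>s. s \<in> S \<Longrightarrow> (\<lambda>m. g m s) \<longlonglongrightarrow> f s"
  shows "(\<lambda>m. ddiff (g m) S) \<longlonglongrightarrow> ddiff f S"
  unfolding ddiff_def divide_inverse
  by (intro tendsto_sum_lf tendsto_mult_lf tendsto_const assms)

text \<open>If \<open>S\<close> meets both \<open>B\<close> and its complement, apply the recursion
  to one point of each kind: dividing by \<open>a - b\<close> costs a factor at most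
  \<open>1 / \<delta>\<close>. Otherwise the function is constant on \<open>S\<close>, and only the
  quotient of order 0 can survive. The powers of \<open>\<delta>\<close> are multiplied out to avoid
  negative exponents.\<close>

lemma ddiff_indicator_le:
  assumes sep: "\<And>a b. a \<in> S \<inter> B \<Longrightarrow> b \<in> S - B \<Longrightarrow> N (a - b) \<ge> \<delta>" and \<delta>: "\<delta> > 0" and S: "finite S"
  shows "N (ddiff (\<lambda>x. if x \<in> B then 1 else 0) S) * \<delta> ^ card S \<le> \<delta>"
  using S sep
proof (induction "card S" arbitrary: S rule: less_induct)
  case less
  define g where "g = (\<lambda>x. if x \<in> B then 1 else 0 :: 'a)"
  have g1: "ddiff g S = ddiff (\<lambda>_. 1) S" if "S \<subseteq> B"
    by (rule ddiff_cong) (use that in \<open>auto simp: g_def\<close>)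
  consider "S \<inter> B = {}" | "S \<subseteq> B" "card S \<ge> 2" | "S \<subseteq> B" "card S = 1"
    | a b where "a \<in> S \<inter> B" "b \<in> S - B"
  proof -
    have "card S \<ge> 2" if "card S \<noteq> 1" "S \<inter> B \<noteq> {}"
    proof -
      have "card S \<noteq> 0"
        using that less.prems by auto
      with that show ?thesis
        by linarith
    qed
    then show ?thesis
      using that by blast
  qed
  then have "N (ddiff g S) * \<delta> ^ card S \<le> \<delta>"
  proof cases
    case 1
    then have "ddiff g S = 0"
      by (intro ddiff_zero) (auto simp: g_def)
    then show ?thesis
      using \<delta> by simp
  next
    case 2
    then show ?thesis
      using \<delta> less.prems by (simp add: g1 ddiff_const)
  next
    case 3
    then obtain s where "S = {s}"
      by (auto simp: card_1_singleton_iff)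
    then show ?thesis
      using 3 by (simp add: g_def)
  next
    case 4
    define S' where "S' = S - {a, b}"
    have S: "S = insert a (insert b S')" "a \<notin> S'" "b \<notin> S'" "a \<noteq> b" "finite S'"
      using 4 less.prems by (auto simp: S'_def)
    have IH: "N (ddiff g (insert c S')) * \<delta> ^ card (insert c S') \<le> \<delta>" if "c \<in> {a, b}" for c
      unfolding g_def using S that less.prems(2) by (intro less.hyps) auto
    have c: "card S = Suc (Suc (card S'))"
      using S by simp
    have "N (a - b) * N (ddiff g S) = N (ddiff g (insert a S') - ddiff g (insert b S'))"
      using ddiff_rec[OF S(5,2,3,4), of g] S(1) by (simp flip: absval_mult)
    also have "\<dots> \<le> \<delta> / \<delta> ^ Suc (card S')"
      using IH[of a] IH[of b] S \<delta> by (intro absval_diff_le) (simp_all add: pos_le_divide_eq)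
    finally have *: "N (a - b) * N (ddiff g S) * \<delta> ^ Suc (card S') \<le> \<delta>"
      using \<delta> by (simp add: pos_le_divide_eq)
    have "N (ddiff g S) * \<delta> ^ card S = \<delta> * N (ddiff g S) * \<delta> ^ Suc (card S')"
      by (simp add: c)
    also have "\<dots> \<le> N (a - b) * N (ddiff g S) * \<delta> ^ Suc (card S')"
      using 4 less.prems(2) \<delta> by (intro mult_right_mono) auto
    also note *
    finally show ?thesis .
  qed
  then show ?case
    by (simp add: g_def)
qed

text \<open>A quotient of order k of the cut-off monomial of degree \<open>j\<close> is at most
  \<open>\<delta>\<close> to the power j - k. In the induction on \<open>j\<close>, the Leibniz rule
  at a node \<open>a\<close> inside \<open>B\<close> gains a factor \<open>\<delta>\<close> in both
  terms: once from \<open>a - r\<close>, once from having one node fewer.\<close>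

lemma ddiff_ball_monomial_le:
  assumes S: "finite S" and \<delta>: "\<delta> > 0"
    and sep: "\<And>a b. a \<in> S \<inter> B \<Longrightarrow> b \<in> S - B \<Longrightarrow> N (a - b) \<ge> \<delta>"
    and rad: "\<And>a. a \<in> S \<inter> B \<Longrightarrow> N (a - r) \<le> \<delta>"
  shows "N (ddiff (\<lambda>x. if x \<in> B then (x - r) ^ j else 0) S) * \<delta> ^ card S \<le> \<delta> ^ Suc j"
  using S sep rad
proof (induction j arbitrary: S)
  case 0
  then show ?case
    using ddiff_indicator_le[of S B \<delta>] \<delta> by (simp cong: if_cong)
next
  case (Suc j)
  define g where "g = (\<lambda>x. if x \<in> B then (x - r) ^ j else 0)"
  have eq: "(\<lambda>x. if x \<in> B then (x - r) ^ Suc j else 0) = (\<lambda>x. (x - r) * g x)"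
    by (auto simp: g_def)
  show ?case
  proof (cases "S \<inter> B = {}")
    case True
    then have "ddiff (\<lambda>x. (x - r) * g x) S = 0"
      by (intro ddiff_zero) (auto simp: g_def)
    then show ?thesis
      unfolding eq using \<delta> by simp
  next
    case False
    then obtain a where a: "a \<in> S" "a \<in> B"
      by auto
    have cS: "card S = Suc (card (S - {a}))"
      using card_Suc_Diff1[OF Suc.prems(1) a(1)] by simp
    have IH: "N (ddiff g S') * \<delta> ^ card S' \<le> \<delta> ^ Suc j" if "S' \<subseteq> S" for S'
      unfolding g_def using that Suc.prems finite_subset by (intro Suc.IH) blast+
    have "N (ddiff (\<lambda>x. (x - r) * g x) S) =
        N ((a - r) * ddiff g S + ddiff g (S - {a}))"
      using a Suc.prems by (subst ddiff_mult_linear[of S a]) auto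
    also have "\<dots> \<le> \<delta> ^ Suc (Suc j) / \<delta> ^ card S"
    proof (rule absval_add_le)
      have "N (a - r) * (N (ddiff g S) * \<delta> ^ card S) \<le> \<delta> * \<delta> ^ Suc j"
        using Suc.prems(3)[of a] a IH[of S] \<delta> by (intro mult_mono) auto
      then show "N ((a - r) * ddiff g S) \<le> \<delta> ^ Suc (Suc j) / \<delta> ^ card S"
        using \<delta> by (simp add: pos_le_divide_eq absval_mult mult.assoc)
      have "\<delta> * (N (ddiff g (S - {a})) * \<delta> ^ card (S - {a})) \<le> \<delta> * \<delta> ^ Suc j"
        using IH[of "S - {a}"] \<delta> by (intro mult_left_mono) auto
      then show "N (ddiff g (S - {a})) \<le> \<delta> ^ Suc (Suc j) / \<delta> ^ card S"
        unfolding cS using \<delta> by (simp add: pos_le_divide_eq mult_ac)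
    qed
    finally show ?thesis
      unfolding eq using \<delta> by (simp add: pos_le_divide_eq)
  qed
qed

section \<open>Taylor polynomials: change of centre and convergence\<close>

definition taylor :: "nat \<Rightarrow> ('a \<Rightarrow> 'a) \<Rightarrow> 'a \<Rightarrow> 'a \<Rightarrow> 'a" where
  "taylor n f c x = (\<Sum>j<n. (x - c) ^ j * D_op v j f c)"

text \<open>Expand both polynomials in powers of \<open>x - r\<close>. The coefficient of degree
  \<open>i\<close> is \<open>D_op v i f r\<close> for the first; for the second it is the value at
  \<open>r\<close> of the Taylor polynomial of \<open>D_op v i f\<close> at \<open>y\<close>, of
  degree \<open>n - 1 - i\<close>. Their difference is the remainder measured by
  \<open>psi\<close>.\<close>

lemma taylor_recentre:
  assumes f: "f \<in> C_class v n" and R: "r \<in> R" "y \<in> R" and "r \<noteq> y"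
  shows "taylor n f r x - taylor n f y x =
    (\<Sum>i<n. ((r - y) ^ (n - i) * psi v (n - 1 - i) (D_op v i f) r y) * (x - r) ^ i)"
proof -
  have coeff: "(r - y) ^ (n - i) * psi v (n - 1 - i) (D_op v i f) r y =
      D_op v i f r - (\<Sum>l<n - i. of_nat (i + l choose i) * (r - y) ^ l * D_op v (i + l) f y)"
    if i: "i < n" for i
  proof -
    have h: "D_op v i f \<in> C_class v (n - i)"
      using i by (intro C_class_D_op[OF f]) auto
    have "psi v (n - 1 - i) (D_op v i f) r y = PhiL (D_op v i f) (r # replicate (Suc (n - 1 - i)) y)"
      using i R \<open>r \<noteq> y\<close> by (intro psi_eq_PhiL[OF h]) auto
    moreover have "Suc (n - 1 - i) = n - i"
      using i by simp
    ultimately have "psi v (n - 1 - i) (D_op v i f) r y = PhiL (D_op v i f) (r # replicate (n - i) y)"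
      by metis
    then have "(r - y) ^ (n - i) * psi v (n - 1 - i) (D_op v i f) r y =
        D_op v i f r - (\<Sum>l<n - i. (r - y) ^ l * D_op v l (D_op v i f) y)"
      using taylor_remainder[OF h R, of "n - i"] by simp
    also have "(\<Sum>l<n - i. (r - y) ^ l * D_op v l (D_op v i f) y) =
        (\<Sum>l<n - i. of_nat (i + l choose i) * (r - y) ^ l * D_op v (i + l) f y)"
    proof (rule sum.cong)
      fix l assume "l \<in> {..<n - i}"
      then show "(r - y) ^ l * D_op v l (D_op v i f) y =
          of_nat (i + l choose i) * (r - y) ^ l * D_op v (i + l) f y"
        using R D_op_D_op[OF f, of l i y] binomial_symmetric[of l "l + i"]
        by (simp add: add.commute)
    qed simp
    finally show ?thesis .
  qed
  have "(\<Sum>i<n. ((r - y) ^ (n - i) * psi v (n - 1 - i) (D_op v i f) r y) * (x - r) ^ i) =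
      (\<Sum>i<n. (D_op v i f r - (\<Sum>l<n - i. of_nat (i + l choose i) * (r - y) ^ l * D_op v (i + l) f y))
        * (x - r) ^ i)"
    by (intro sum.cong refl) (simp only: coeff lessThan_iff)
  also have "\<dots> = taylor n f r x - (\<Sum>i<n. \<Sum>l<n - i.
        of_nat (i + l choose i) * (x - r) ^ i * (r - y) ^ l * D_op v (i + l) f y)"
    by (simp add: taylor_def right_diff_distrib sum_subtractf sum_distrib_left mult_ac)
  also have "(\<Sum>i<n. \<Sum>l<n - i. of_nat (i + l choose i) * (x - r) ^ i * (r - y) ^ l * D_op v (i + l) f y) =
      (\<Sum>(i, l)\<in>{(i, l). i + l < n}. of_nat (i + l choose i) * (x - r) ^ i * (r - y) ^ l * D_op v (i + l) f y)"
  proof -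
    have "{(i, l). i + l < n} = (SIGMA i:{..<n}. {..<n - i})"
      by auto
    then show ?thesis
      by (simp add: sum.Sigma)
  qed
  \<comment> \<open>Collecting by \<open>k = i + l\<close> prepares the binomial theorem for
    \<open>x - y = (x - r) + (r - y)\<close>.\<close>
  also have "\<dots> = (\<Sum>k<n. \<Sum>i\<le>k. of_nat (k choose i) * (x - r) ^ i * (r - y) ^ (k - i) * D_op v k f y)"
    by (subst sum.triangle_reindex) simp
  also have "\<dots> = taylor n f y x"
  proof -
    have "(x - y) ^ k = (\<Sum>i\<le>k. of_nat (k choose i) * (x - r) ^ i * (r - y) ^ (k - i))" for k
      using binomial_ring[of "x - r" "r - y" k] by simp
    then show ?thesis
      by (simp add: taylor_def sum_distrib_right)
  qed
  finally show ?thesis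
    by simp
qed

text \<open>The coefficients are continuous in the centre, and at the centre \<open>x\<close> itself
  only the term of degree 0 remains.\<close>

lemma taylor_tendsto:
  assumes f: "f \<in> C_class v n" and "n \<ge> 1" and x: "x \<in> R"
    and c: "c \<longlonglongrightarrow> x" "\<And>m. c m \<in> R"
  shows "(\<lambda>m. taylor n f (c m) x) \<longlonglongrightarrow> f x"
proof -
  have D: "(\<lambda>m. D_op v j f (c m)) \<longlonglongrightarrow> D_op v j f x" if "j < n" for j
  proof -
    have "(\<lambda>m. PhiL f (map (\<lambda>g. g m) (replicate (Suc j) c))) \<longlonglongrightarrow>
        PhiL f (map (\<lambda>_. x) (replicate (Suc j) c))"
      using that c x by (intro tendsto_PhiL[OF C_class_mono[OF f, of j]]) auto
    then show ?thesis
      by (simp add: D_op_eq_PhiL)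
  qed
  have "(\<lambda>m. taylor n f (c m) x) \<longlonglongrightarrow> taylor n f x x"
    unfolding taylor_def
    using D c by (intro tendsto_sum_lf tendsto_mult_lf tendsto_power_lf tendsto_diff_lf tendsto_const) auto
  also have "taylor n f x x = (\<Sum>j<n. if j = 0 then D_op v 0 f x else 0)"
    unfolding taylor_def by (intro sum.cong) auto
  also have "\<dots> = f x"
    using assms PhiL_single[OF C_class_mono[OF f, of 0] x] by (simp add: D_op_eq_PhiL)
  finally show ?thesis .
qed

end

section \<open>Digit expansions and the two norms\<close>

locale digit_system = local_field v for v :: "'a::{field, metric_space} \<Rightarrow> int" +
  fixes \<pi> :: 'a and T :: "'a set"
  assumes unif: "uniformizer v \<pi>" and reps: "residue_representatives v T"
begin

lemma pi_nonzero [simp]: "\<pi> \<noteq> 0" and v_pi: "v \<pi> = 1"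
  using unif by (simp_all add: uniformizer_def)

lemmas N_pi = absval_uniformizer[OF pi_nonzero v_pi]

lemma pi_in_R: "\<pi> \<in> R"
  by (simp add: val_ring_def v_pi)

lemma T_subset: "t \<in> T \<Longrightarrow> t \<in> R" and zero_in_T: "0 \<in> T"
  using reps by (auto simp: residue_representatives_def)

lemma N_pi_power: "N (\<pi> ^ m) = q powi (- int m)"
  using N_pi by (simp add: absval_power power_int_minus power_one_over inverse_eq_divide)

lemma absval_le_pi_power: "N x \<le> N (\<pi> ^ m) \<longleftrightarrow> x = 0 \<or> int m \<le> v x"
proof (cases "x = 0")
  case False
  have "q powi (- v x) \<le> q powi (- int m) \<longleftrightarrow> - v x \<le> - int m"
    using q_gt_1 power_int_increasing[of "- v x" "- int m" q]
      power_int_strict_increasing[of "- int m" "- v x" q] by linarith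
  with False show ?thesis
    unfolding N_pi_power by (simp add: absval_def)
qed simp

text \<open>The valuation is integral, so no absolute value lies strictly between those of
  consecutive powers of \<open>\<pi>\<close>.\<close>

lemma absval_gt_pi_power: "\<not> N x \<le> N (\<pi> ^ Suc m) \<Longrightarrow> N (\<pi> ^ m) \<le> N x"
proof -
  assume "\<not> N x \<le> N (\<pi> ^ Suc m)"
  then have "x \<noteq> 0" "v x \<le> int m"
    unfolding absval_le_pi_power by auto
  then show ?thesis
    unfolding N_pi_power using q_gt_1 by (simp add: absval_def power_int_increasing)
qed

lemma max_ideal_iff: "x \<in> max_ideal v \<longleftrightarrow> N x \<le> N \<pi>"
  using absval_le_pi_power[of x 1] by (simp add: max_ideal_def)

lemma N_pi_power_pos: "0 < N (\<pi> ^ m)"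
  using N_pi by (simp add: absval_power)

lemma N_pi_power_mono: "k \<le> m \<Longrightarrow> N (\<pi> ^ m) \<le> N (\<pi> ^ k)"
  using N_pi unfolding absval_power by (intro power_decreasing) linarith+

lemma N_pi_power_le_1: "N (\<pi> ^ m) \<le> 1"
  using N_pi_power_mono[of 0 m] by simp

section \<open>Digits and truncations\<close>

definition digit :: "'a \<Rightarrow> 'a" where
  "digit x = (THE t. t \<in> T \<and> x - t \<in> max_ideal v)"

lemma digit: "x \<in> R \<Longrightarrow> digit x \<in> T" "x \<in> R \<Longrightarrow> x - digit x \<in> max_ideal v"
  using theI'[of "\<lambda>t. t \<in> T \<and> x - t \<in> max_ideal v"] reps
  by (simp_all add: digit_def residue_representatives_def)

lemma digit_unique:
  assumes "x \<in> R" "s \<in> T" "t \<in> T" "x - s \<in> max_ideal v" "x - t \<in> max_ideal v"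
  shows "s = t"
  using assms reps by (auto simp: residue_representatives_def)

lemma digit_cong:
  assumes "x \<in> R" "y \<in> R" "x - y \<in> max_ideal v"
  shows "digit x = digit y"
proof (rule digit_unique[OF \<open>x \<in> R\<close>])
  have "(x - y) + (y - digit y) \<in> max_ideal v"
    using assms digit by (intro max_ideal_add) auto
  then show "x - digit y \<in> max_ideal v"
    by simp
qed (use assms digit in auto)

text \<open>Greedy extraction of the first \<open>m\<close> digits: the next digit represents the
  residue class of the rescaled remainder.\<close>

primrec trunc :: "nat \<Rightarrow> 'a \<Rightarrow> 'a" where
  "trunc 0 x = 0"
| "trunc (Suc m) x = trunc m x + digit ((x - trunc m x) / \<pi> ^ m) * \<pi> ^ m"

lemma trunc_dist: "x \<in> R \<Longrightarrow> N (x - trunc m x) \<le> N (\<pi> ^ m)"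
proof (induction m)
  case 0
  then show ?case
    by (simp add: val_ring_iff_absval)
next
  case (Suc m)
  define y where "y = (x - trunc m x) / \<pi> ^ m"
  have "y \<in> R"
    using Suc N_pi_power_pos[of m] by (simp add: val_ring_iff_absval y_def absval_divide divide_le_eq)
  then have "N (y - digit y) * N (\<pi> ^ m) \<le> N \<pi> * N (\<pi> ^ m)"
    using digit(2) by (intro mult_right_mono) (auto simp flip: max_ideal_iff)
  moreover have "x - trunc (Suc m) x = (y - digit y) * \<pi> ^ m"
    by (simp add: y_def left_diff_distrib diff_divide_distrib)
  ultimately show ?case
    by (simp only: absval_mult power_Suc)
qed

lemma trunc_quotient_in_R: "x \<in> R \<Longrightarrow> (x - trunc m x) / \<pi> ^ m \<in> R"
  using trunc_dist[of x m] N_pi_power_pos[of m]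
  by (simp add: val_ring_iff_absval absval_divide divide_le_eq)

lemma trunc_in_R: "x \<in> R \<Longrightarrow> trunc m x \<in> R"
  using val_ring_diff[of x "x - trunc m x"] trunc_dist[of x m] N_pi_power_le_1[of m]
  by (simp add: val_ring_iff_absval)

text \<open>Close points have rescaled remainders in the same residue class at every stage.
  Contrapositively, points with different truncations to \<open>m + 1\<close> digits are at distance
  at least \<open>N (\<pi> ^ m)\<close>, by \<open>absval_gt_pi_power\<close>.\<close>

lemma trunc_cong: "x \<in> R \<Longrightarrow> y \<in> R \<Longrightarrow> N (x - y) \<le> N (\<pi> ^ m) \<Longrightarrow> trunc m x = trunc m y"
proof (induction m)
  case (Suc m)
  have "N (\<pi> ^ Suc m) \<le> N (\<pi> ^ m)"
    by (rule N_pi_power_mono) simp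
  with Suc have eq: "trunc m x = trunc m y"
    by simp
  have "N (x - y) / N (\<pi> ^ m) \<le> N \<pi>"
    using Suc.prems(3) N_pi_power_pos[of m] by (simp add: pos_divide_le_eq absval_mult)
  then have "(x - trunc m x) / \<pi> ^ m - (y - trunc m y) / \<pi> ^ m \<in> max_ideal v"
    by (simp add: max_ideal_iff eq diff_divide_distrib[symmetric] absval_divide)
  then have "digit ((x - trunc m x) / \<pi> ^ m) = digit ((y - trunc m y) / \<pi> ^ m)"
    using Suc.prems by (intro digit_cong trunc_quotient_in_R)
  with eq show ?case
    by simp
qed simp

lemma trunc_expansion: "trunc m x = (\<Sum>i<m. digit ((x - trunc i x) / \<pi> ^ i) * \<pi> ^ i)"
  by (induction m) simp_all

lemma trunc_tendsto:
  assumes "x \<in> R"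
  shows "(\<lambda>m. trunc m x) \<longlonglongrightarrow> x"
proof (rule tendsto_absval_bound)
  show "(\<lambda>m. N \<pi> ^ m) \<longlonglongrightarrow> 0"
    using N_pi by (intro LIMSEQ_power_zero) simp
  show "N (trunc m x - x) \<le> N \<pi> ^ m" for m
    using trunc_dist[OF assms, of m] by (simp add: absval_diff_commute absval_power)
qed

section \<open>Uniqueness of finite expansions and deletion of the leading digit\<close>

lemma digit_sum_in_R:
  assumes "\<And>i. i \<in> I \<Longrightarrow> a i \<in> T"
  shows "(\<Sum>i\<in>I. a i * \<pi> ^ i) \<in> R"
proof (rule val_ring_sum)
  fix i assume "i \<in> I"
  then show "a i * \<pi> ^ i \<in> R"
    by (intro val_ring_mult val_ring_power pi_in_R T_subset assms)
qed

text \<open>Reduction modulo \<open>\<pi>\<close> identifies the lowest digits; subtract them,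
  cancel \<open>\<pi>\<close> and induct on the shifted sequences.\<close>

lemma digits_unique:
  assumes "\<forall>i<m. a i \<in> T" "\<forall>i<m. b i \<in> T" "(\<Sum>i<m. a i * \<pi> ^ i) = (\<Sum>i<m. b i * \<pi> ^ i)"
  shows "\<forall>i<m. a i = b i"
  using assms
proof (induction m arbitrary: a b)
  case (Suc m)
  define A where "A c = (\<Sum>i<m. c (Suc i) * \<pi> ^ i)" for c :: "nat \<Rightarrow> 'a"
  have split: "(\<Sum>i<Suc m. c i * \<pi> ^ i) = c 0 + \<pi> * A c" for c
    unfolding sum.lessThan_Suc_shift by (simp add: A_def sum_distrib_left mult_ac)
  have AR: "A a \<in> R" "A b \<in> R"
    unfolding A_def using Suc.prems(1,2) by (intro digit_sum_in_R; simp)+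
  have eq: "a 0 + \<pi> * A a = b 0 + \<pi> * A b"
    using Suc.prems(3) by (simp only: split)
  then have "a 0 - b 0 = \<pi> * (A b - A a)"
    by (simp add: algebra_simps)
  moreover have "N (\<pi> * (A b - A a)) \<le> N \<pi>"
    using val_ring_diff[OF AR(2,1)] unfolding absval_mult val_ring_iff_absval
    by (rule mult_left_le) simp
  ultimately have "a 0 - b 0 \<in> max_ideal v"
    by (simp add: max_ideal_iff)
  then have 0: "a 0 = b 0"
    using Suc.prems by (intro digit_unique[of "a 0"]) (auto simp: T_subset max_ideal_def)
  with eq have "A a = A b"
    by simp
  then have "\<forall>i<m. a (Suc i) = b (Suc i)"
    using Suc.prems by (intro Suc.IH) (auto simp: A_def)
  with 0 show ?case
    by (auto simp: less_Suc_eq_0_disj)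
qed simp

lemma r_minus_eq:
  assumes a: "\<forall>i\<le>m. a i \<in> T" "a m \<noteq> 0"
  shows "r_minus \<pi> T (\<Sum>i\<le>m. a i * \<pi> ^ i) = (\<Sum>i<m. a i * \<pi> ^ i)"
  unfolding r_minus_def
proof (rule the_equality)
  fix s assume "\<exists>b k. (\<forall>i\<le>k. b i \<in> T) \<and> b k \<noteq> 0 \<and>
    (\<Sum>i\<le>m. a i * \<pi> ^ i) = (\<Sum>i\<le>k. b i * \<pi> ^ i) \<and> s = (\<Sum>i<k. b i * \<pi> ^ i)"
  then obtain b k where b: "\<forall>i\<le>k. b i \<in> T" "b k \<noteq> 0"
    "(\<Sum>i\<le>m. a i * \<pi> ^ i) = (\<Sum>i\<le>k. b i * \<pi> ^ i)" "s = (\<Sum>i<k. b i * \<pi> ^ i)"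
    by blast
  define M where "M = Suc (max m k)"
  \<comment> \<open>Expansions of different lengths become comparable after filling up with the
    digit 0; the nonzero leading digits then force equal lengths.\<close>
  define pad where "pad c l i = (if i \<le> l then c i else 0)" for c :: "nat \<Rightarrow> 'a" and l i :: nat
  have pad: "(\<Sum>i\<le>l. c i * \<pi> ^ i) = (\<Sum>i<M. pad c l i * \<pi> ^ i)" if "l < M" for c l
    using that by (intro sum.mono_neutral_cong_left) (auto simp: pad_def)
  have "\<forall>i<M. pad a m i = pad b k i"
  proof (rule digits_unique)
    show "(\<Sum>i<M. pad a m i * \<pi> ^ i) = (\<Sum>i<M. pad b k i * \<pi> ^ i)"
      using b(3) by (subst (1 2) pad[symmetric]) (simp_all add: M_def)
  qed (use a b zero_in_T in \<open>auto simp: pad_def\<close>)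
  then have eq: "pad a m i = pad b k i" if "i \<le> max m k" for i
    using that by (simp add: M_def less_Suc_eq_le)
  have "m = k"
    using eq[of m] eq[of k] a b by (auto simp: pad_def split: if_splits)
  then have "a i = b i" if "i < m" for i
    using eq[of i] that by (simp add: pad_def)
  then show "s = (\<Sum>i<m. a i * \<pi> ^ i)"
    using \<open>m = k\<close> b(4) by simp
qed (use a in blast)

lemma R_plus_cases:
  assumes "r \<in> R_plus \<pi> T" "r \<noteq> 0"
  obtains a m where "\<forall>i\<le>m. a i \<in> T" "a m \<noteq> 0" "r = (\<Sum>i\<le>m. a i * \<pi> ^ i)"
    "r_minus \<pi> T r = (\<Sum>i<m. a i * \<pi> ^ i)"
proof -
  obtain a M where a: "\<forall>i<M. a i \<in> T" "r = (\<Sum>i<M. a i * \<pi> ^ i)"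
    using assms by (auto simp: R_plus_def R_digits_def)
  \<comment> \<open>Members of \<open>R_digits\<close> may have leading zeros, so the true leading
    position must be located.\<close>
  define m where "m = Max {i. i < M \<and> a i \<noteq> 0}"
  have "{i. i < M \<and> a i \<noteq> 0} \<noteq> {}"
  proof
    assume "{i. i < M \<and> a i \<noteq> 0} = {}"
    then have "r = 0"
      unfolding a(2) by (intro sum.neutral) auto
    with assms show False
      by simp
  qed
  then have "m \<in> {i. i < M \<and> a i \<noteq> 0}"
    unfolding m_def by (intro Max_in) auto
  moreover have "i \<le> m" if "i < M" "a i \<noteq> 0" for i
    unfolding m_def using that by (intro Max_ge) auto
  ultimately have m: "m < M" "a m \<noteq> 0" "\<And>i. i < M \<Longrightarrow> \<not> i \<le> m \<Longrightarrow> a i = 0"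
    by auto
  have r: "r = (\<Sum>i\<le>m. a i * \<pi> ^ i)"
    unfolding a(2) using m by (intro sum.mono_neutral_right) auto
  have "\<forall>i\<le>m. a i \<in> T"
    using a m by auto
  with r m show ?thesis
    by (intro that[of m a]) (auto simp: r_minus_eq)
qed

lemma R_plus_r_minus:
  assumes "r \<in> R_plus \<pi> T" "r \<noteq> 0"
  shows "r \<in> R" "r_minus \<pi> T r \<in> R" "r \<noteq> r_minus \<pi> T r"
proof -
  obtain a m where a: "\<forall>i\<le>m. a i \<in> T" "a m \<noteq> 0" "r = (\<Sum>i\<le>m. a i * \<pi> ^ i)"
    "r_minus \<pi> T r = (\<Sum>i<m. a i * \<pi> ^ i)"
    using assms by (rule R_plus_cases)
  show "r \<in> R" "r_minus \<pi> T r \<in> R"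
    unfolding a(4) by (simp_all only: a(3), (intro digit_sum_in_R, use a(1) in simp)+)
  have "r = r_minus \<pi> T r + a m * \<pi> ^ m"
    unfolding a(4) by (simp add: a(3) flip: lessThan_Suc_atMost)
  with a(2) show "r \<noteq> r_minus \<pi> T r"
    by auto
qed

text \<open>A zero digit changes nothing, a nonzero one becomes the leading digit. This is how
  consecutive truncations produce the pairs at which the digit norm samples
  \<open>psi\<close>.\<close>

lemma trunc_Suc_cases:
  assumes x: "x \<in> R"
  obtains "trunc (Suc m) x = trunc m x"
  | "trunc (Suc m) x \<in> R_plus \<pi> T" "trunc (Suc m) x \<noteq> 0" "r_minus \<pi> T (trunc (Suc m) x) = trunc m x"
proof (cases "digit ((x - trunc m x) / \<pi> ^ m) = 0")
  case True
  then show ?thesis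
    using that(1) by simp
next
  case False
  define a where "a i = digit ((x - trunc i x) / \<pi> ^ i)" for i
  have aT: "a i \<in> T" for i
    unfolding a_def using digit trunc_quotient_in_R x by blast
  have exp: "trunc m x = (\<Sum>i<m. a i * \<pi> ^ i)" "trunc (Suc m) x = (\<Sum>i<Suc m. a i * \<pi> ^ i)"
    unfolding a_def by (rule trunc_expansion)+
  have "trunc (Suc m) x \<noteq> 0"
  proof
    assume "trunc (Suc m) x = 0"
    then have "(\<Sum>i<Suc m. a i * \<pi> ^ i) = (\<Sum>i<Suc m. 0 * \<pi> ^ i)"
      using exp(2) by simp
    then have "\<forall>i<Suc m. a i = 0"
      using aT zero_in_T by (intro digits_unique) auto
    with False show False
      by (simp add: a_def)
  qed
  moreover have "trunc (Suc m) x \<in> R_plus \<pi> T"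
    unfolding R_plus_def R_digits_def exp(2) using aT by (auto simp del: sum.lessThan_Suc)
  moreover have "r_minus \<pi> T (trunc (Suc m) x) = trunc m x"
    unfolding exp lessThan_Suc_atMost using aT False by (intro r_minus_eq) (auto simp: a_def)
  ultimately show ?thesis
    by (intro that(2))
qed

section \<open>Every bound for the digit norm bounds all quotients of order at most n\<close>

context
  fixes f :: "'a \<Rightarrow> 'a" and n :: nat and B :: real
  assumes f: "f \<in> C_class v n" and n: "n \<ge> 1"
    and B_D: "\<And>j. j < n \<Longrightarrow> N (D_op v j f 0) \<le> B"
    and B_psi: "\<And>r j. r \<in> R_plus \<pi> T \<Longrightarrow> r \<noteq> 0 \<Longrightarrow> j < n \<Longrightarrow>
      N (psi v (n - 1 - j) (D_op v j f) r (r_minus \<pi> T r)) \<le> B"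
begin

lemma B_nonneg: "0 \<le> B"
  using n by (intro order_trans[OF absval_nonneg B_D[of 0]]) simp

lemma ddiff_taylor_0_le:
  assumes S: "finite S" "S \<subseteq> R"
  shows "N (ddiff (\<lambda>x. taylor n f (trunc 0 x) x) S) \<le> B"
proof -
  have "ddiff (\<lambda>x. taylor n f (trunc 0 x) x) S =
      (\<Sum>j<n. D_op v j f 0 * ddiff (\<lambda>x. (x - 0) ^ j) S)"
    by (simp add: taylor_def ddiff_sum mult.commute[of _ "D_op v _ f 0"] ddiff_cmult)
  also have "N \<dots> \<le> B"
  proof (rule absval_sum_le[OF B_nonneg])
    fix j assume "j \<in> {..<n}"
    \<comment> \<open>With \<open>UNIV\<close> in place of the ball the separation condition is
      vacuous, and \<open>S\<close> lies in the ball of radius 1 about 0.\<close>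
    moreover have "N (ddiff (\<lambda>x. (x - 0) ^ j) S) \<le> 1"
      using ddiff_ball_monomial_le[of S 1 UNIV 0 j] S by (auto simp: val_ring_iff_absval subset_iff)
    ultimately have "N (D_op v j f 0) * N (ddiff (\<lambda>x. (x - 0) ^ j) S) \<le> B * 1"
      using B_nonneg by (intro mult_mono B_D) auto
    then show "N (D_op v j f 0 * ddiff (\<lambda>x. (x - 0) ^ j) S) \<le> B"
      by (simp only: absval_mult)
  qed
  finally show ?thesis .
qed

text \<open>With \<open>\<delta> = N (\<pi> ^ m)\<close>, the coefficient of degree \<open>i\<close>
  is at most \<open>\<delta> ^ (n - i) * B\<close>, while the quotient of the cut-off monomial is at
  most \<open>\<delta>\<close> to the power i + 1 - card S. The product is at most \<open>B\<close>
  because \<open>\<delta> \<le> 1\<close> and \<open>card S \<le> n + 1\<close>.\<close>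

lemma ddiff_taylor_step_ball_le:
  assumes S: "finite S" "S \<subseteq> R" "card S \<le> Suc n" and r: "x0 \<in> R" "r = trunc (Suc m) x0"
  shows "N (ddiff (\<lambda>x. if trunc (Suc m) x = r then taylor n f r x - taylor n f (trunc m x0) x else 0) S) \<le> B"
proof (cases rule: trunc_Suc_cases[OF r(1), of m])
  case 1
  then show ?thesis
    using B_nonneg by (simp add: r(2) ddiff_zero)
next
  case 2
  define y where "y = trunc m x0"
  define \<delta> where "\<delta> = N (\<pi> ^ m)"
  define E where "E = {x. trunc (Suc m) x = r}"
  define c where "c i = (r - y) ^ (n - i) * psi v (n - 1 - i) (D_op v i f) r y" for i
  have \<delta>: "0 < \<delta>" "\<delta> \<le> 1" "N (\<pi> ^ Suc m) \<le> \<delta>"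
    unfolding \<delta>_def by (intro N_pi_power_pos N_pi_power_le_1 N_pi_power_mono; simp)+
  have rp: "r \<in> R_plus \<pi> T" "r \<noteq> 0" and y: "r_minus \<pi> T r = y"
    using 2 by (simp_all add: r(2) y_def)
  note R = R_plus_r_minus[OF rp, unfolded y]
  have "ddiff (\<lambda>x. if trunc (Suc m) x = r then taylor n f r x - taylor n f y x else 0) S =
      ddiff (\<lambda>x. \<Sum>i<n. c i * (if x \<in> E then (x - r) ^ i else 0)) S"
    unfolding taylor_recentre[OF f R] by (rule ddiff_cong) (simp add: c_def E_def)
  also have "\<dots> = (\<Sum>i<n. c i * ddiff (\<lambda>x. if x \<in> E then (x - r) ^ i else 0) S)"
    by (simp add: ddiff_sum ddiff_cmult)
  also have "N \<dots> \<le> B"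
  proof (rule absval_sum_le[OF B_nonneg])
    fix i assume i: "i \<in> {..<n}"
    define d where "d = ddiff (\<lambda>x. if x \<in> E then (x - r) ^ i else 0) S"
    have "N d * \<delta> ^ card S \<le> \<delta> ^ Suc i"
      unfolding d_def
    proof (rule ddiff_ball_monomial_le)
      fix a b assume ab: "a \<in> S \<inter> E" "b \<in> S - E"
      have "\<not> N (a - b) \<le> N (\<pi> ^ Suc m)"
      proof
        assume "N (a - b) \<le> N (\<pi> ^ Suc m)"
        then have "trunc (Suc m) a = trunc (Suc m) b"
          using ab S by (intro trunc_cong) auto
        with ab show False
          by (simp add: E_def)
      qed
      then show "N (a - b) \<ge> \<delta>"
        unfolding \<delta>_def by (rule absval_gt_pi_power)
    next
      fix a assume "a \<in> S \<inter> E"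
      then have "N (a - r) \<le> N (\<pi> ^ Suc m)"
        using trunc_dist[of a "Suc m"] S by (auto simp: E_def simp del: trunc.simps)
      with \<delta>(3) show "N (a - r) \<le> \<delta>"
        by linarith
    qed (use S \<delta> in auto)
    then have "\<delta> ^ (n - i) * (N d * \<delta> ^ card S) \<le> \<delta> ^ (n - i) * \<delta> ^ Suc i"
      using \<delta> by (intro mult_left_mono) auto
    also have "\<dots> = \<delta> ^ Suc n"
      using i by (simp flip: power_add power_Suc)
    also have "\<dots> \<le> \<delta> ^ card S"
      using S \<delta> by (intro power_decreasing) auto
    finally have d: "\<delta> ^ (n - i) * N d \<le> 1"
      using \<delta> by (simp add: mult.assoc[symmetric])
    have "N (r - y) \<le> \<delta>"
    proof -
      have "N (x0 - r) \<le> \<delta>"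
        using trunc_dist[OF r(1), of "Suc m"] \<delta>(3) unfolding r(2) by linarith
      moreover have "N (x0 - y) \<le> \<delta>"
        using trunc_dist[OF r(1), of m] by (simp add: y_def \<delta>_def)
      ultimately have "N (x0 - y - (x0 - r)) \<le> \<delta>"
        by (rule absval_diff_le[rotated])
      then show ?thesis
        by simp
    qed
    then have "N (c i) \<le> \<delta> ^ (n - i) * B"
      unfolding c_def absval_mult absval_power using B_psi[OF rp, of i] i y \<delta>
      by (intro mult_mono power_mono) auto
    then have "N (c i) * N d \<le> \<delta> ^ (n - i) * B * N d"
      by (rule mult_right_mono) simp
    also have "\<dots> = (\<delta> ^ (n - i) * N d) * B"
      by simp
    also have "\<dots> \<le> 1 * B"
      using d B_nonneg by (rule mult_right_mono)
    finally show "N (c i * ddiff (\<lambda>x. if x \<in> E then (x - r) ^ i else 0) S) \<le> B"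
      by (simp add: absval_mult d_def)
  qed
  finally show ?thesis
    by (simp only: y_def)
qed

text \<open>Passing from \<open>m\<close> to \<open>m + 1\<close> digits adds one cut-off increment
  for each of the finitely many balls that meet \<open>S\<close>. Each has quotient at most
  \<open>B\<close>, so by the ultrametric inequality the bound does not grow with
  \<open>m\<close>.\<close>

lemma ddiff_taylor_trunc_le:
  assumes S: "finite S" "S \<subseteq> R" "card S \<le> Suc n"
  shows "N (ddiff (\<lambda>x. taylor n f (trunc m x) x) S) \<le> B"
proof (induction m)
  case 0
  show ?case
    using S by (intro ddiff_taylor_0_le)
next
  case (Suc m)
  define t where "t = trunc (Suc m)"
  \<comment> \<open>The old centre is written \<open>trunc m r\<close>, making the increment depend
    on the ball alone; \<open>tm\<close> shows that it equals \<open>trunc m x\<close>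
    there.\<close>
  define F where "F r x = (if t x = r then taylor n f r x - taylor n f (trunc m r) x else 0)" for r x
  have tm: "trunc m (t x) = trunc m x" if "x \<in> R" for x
  proof (rule trunc_cong)
    have "N (x - t x) \<le> N (\<pi> ^ m)"
      using trunc_dist[OF that, of "Suc m"] N_pi_power_mono[of m "Suc m"] unfolding t_def by linarith
    then show "N (t x - x) \<le> N (\<pi> ^ m)"
      by (simp add: absval_diff_commute)
  qed (use that trunc_in_R in \<open>auto simp: t_def simp del: trunc.simps\<close>)
  have "taylor n f (t x) x = taylor n f (trunc m x) x + (\<Sum>r\<in>t ` S. F r x)" if "x \<in> S" for x
  proof -
    have "(\<Sum>r\<in>t ` S. F r x) = (\<Sum>r\<in>t ` S. if t x = r then taylor n f (t x) x - taylor n f (trunc m x) x else 0)"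
      using tm[of x] that S by (intro sum.cong) (auto simp: F_def)
    then show ?thesis
      using that S by simp
  qed
  then have "ddiff (\<lambda>x. taylor n f (t x) x) S =
      ddiff (\<lambda>x. taylor n f (trunc m x) x + (\<Sum>r\<in>t ` S. F r x)) S"
    by (rule ddiff_cong)
  also have "\<dots> = ddiff (\<lambda>x. taylor n f (trunc m x) x) S + (\<Sum>r\<in>t ` S. ddiff (F r) S)"
    by (simp add: ddiff_add ddiff_sum)
  also have "N \<dots> \<le> B"
  proof (intro absval_add_le Suc.IH absval_sum_le B_nonneg)
    fix r assume "r \<in> t ` S"
    then obtain x0 where x0: "x0 \<in> R" "r = trunc (Suc m) x0"
      using S by (auto simp: t_def)
    then have "trunc m r = trunc m x0"
      using tm[of x0] by (simp only: t_def)
    then show "N (ddiff (F r) S) \<le> B"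
      using ddiff_taylor_step_ball_le[OF S x0] unfolding F_def t_def by (simp only:)
  qed
  finally show ?case
    by (simp only: t_def)
qed

lemma ddiff_le:
  assumes S: "finite S" "S \<subseteq> R" "card S \<le> Suc n"
  shows "N (ddiff f S) \<le> B"
proof -
  have "(\<lambda>m. ddiff (\<lambda>x. taylor n f (trunc m x) x) S) \<longlonglongrightarrow> ddiff f S"
    using S by (intro ddiff_tendsto taylor_tendsto[OF f n] trunc_tendsto trunc_in_R) auto
  then have "(\<lambda>m. N (ddiff (\<lambda>x. taylor n f (trunc m x) x) S)) \<longlonglongrightarrow> N (ddiff f S)"
    by (rule tendsto_absval)
  then show ?thesis
    by (rule LIMSEQ_le_const2) (use ddiff_taylor_trunc_le[OF S] in blast)
qed

lemma PhiL_le_digits_bound: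
  assumes "length xs = Suc j" "j \<le> n" "set xs \<subseteq> R"
  shows "N (PhiL f xs) \<le> B"
  using assms C_class_mono[OF f, of j] by (intro PhiL_le[of f j] ddiff_le) auto

end

section \<open>The converse bound and equality of the norms\<close>

lemma norm_digits_le_iff:
  assumes "n \<ge> 1"
  shows "norm_digits v \<pi> T n f \<le> ereal B \<longleftrightarrow>
    (\<forall>j<n. N (D_op v j f 0) \<le> B) \<and>
    (\<forall>r j. r \<in> R_plus \<pi> T \<longrightarrow> r \<noteq> 0 \<longrightarrow> j < n \<longrightarrow>
      N (psi v (n - 1 - j) (D_op v j f) r (r_minus \<pi> T r)) \<le> B)"
proof -
  have le: "j \<le> n - 1 \<longleftrightarrow> j < n" for j
    using assms by auto
  have D: "(\<forall>a\<in>{ereal (g j) | j. j < n}. a \<le> ereal B) \<longleftrightarrow> (\<forall>j<n. g j \<le> B)" for g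
    by force
  have P: "(\<forall>a\<in>{ereal (g r j) | r j. r \<in> R_plus \<pi> T \<and> r \<noteq> 0 \<and> j < n}. a \<le> ereal B) \<longleftrightarrow>
      (\<forall>r j. r \<in> R_plus \<pi> T \<longrightarrow> r \<noteq> 0 \<longrightarrow> j < n \<longrightarrow> g r j \<le> B)" for g
    by force
  show ?thesis
    unfolding norm_digits_def Sup_le_iff ball_Un le D P ..
qed

lemma norm_digits_le_norm_C_bound:
  assumes f: "f \<in> C_class v n"
    and B: "\<And>j xs. j \<le> n \<Longrightarrow> length xs = Suc j \<Longrightarrow> set xs \<subseteq> R \<Longrightarrow> N (PhiL f xs) \<le> B"
    and j: "j < n"
  shows "N (D_op v j f 0) \<le> B"
    and "r \<in> R_plus \<pi> T \<Longrightarrow> r \<noteq> 0 \<Longrightarrow> N (psi v (n - 1 - j) (D_op v j f) r (r_minus \<pi> T r)) \<le> B"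
proof -
  show D: "N (D_op v j f 0) \<le> B"
    unfolding D_op_eq_PhiL using j by (intro B[of j]) (auto simp: set_replicate_conv_if)
  assume "r \<in> R_plus \<pi> T" "r \<noteq> 0"
  note R = R_plus_r_minus[OF this]
  define xs where "xs = r # replicate (Suc (n - 1 - j)) (r_minus \<pi> T r)"
  have xs: "length xs = Suc (n - j)" "set xs \<subseteq> R"
    using R j by (auto simp: xs_def)
  have "psi v (n - 1 - j) (D_op v j f) r (r_minus \<pi> T r) = PhiL (D_op v j f) xs"
    unfolding xs_def using j R by (intro psi_eq_PhiL[of _ "n - j"] C_class_D_op[OF f]) auto
  also have "\<dots> = spread (PhiM f) j {#} xs"
    using j xs by (intro PhiL_D_op[OF f]) auto
  also have "N \<dots> \<le> B"
  \<comment> \<open>Since \<open>xs\<close> has \<open>n - j + 1\<close> entries and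
    \<open>j\<close> copies are added, every summand has \<open>n + 1\<close> arguments, so it is a
    value of the extended quotient of order \<open>n\<close>.\<close>
  proof (rule absval_spread_le[where k = "Suc n"])
    fix M assume M: "size M = Suc n" "set_mset M \<subseteq> R"
    obtain ys where ys: "mset ys = M"
      using ex_mset by blast
    then have "length ys = Suc n" "set ys \<subseteq> R"
      using M by auto
    then have "N (PhiL f ys) \<le> B" "PhiM f (mset ys) = PhiL f ys"
      by (auto intro!: B[of n] PhiM_mset[OF f])
    with ys show "N (PhiM f M) \<le> B"
      by simp
  next
    show "0 \<le> B"
      by (rule order_trans[OF absval_nonneg D])
  qed (use xs j in auto)
  finally show "N (psi v (n - 1 - j) (D_op v j f) r (r_minus \<pi> T r)) \<le> B" .
qed

theorem norm_digits_eq_norm_C: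
  assumes f: "f \<in> C_class v n" and n: "n \<ge> 1"
  shows "norm_digits v \<pi> T n f = norm_C v n f"
proof -
  have "norm_digits v \<pi> T n f \<le> ereal B \<longleftrightarrow> norm_C v n f \<le> ereal B" for B
    unfolding norm_digits_le_iff[OF n] norm_C_le_iff
  proof (intro iffI conjI allI impI; (elim conjE)?)
    fix j xs
    assume "\<forall>j<n. N (D_op v j f 0) \<le> B" "\<forall>r j. r \<in> R_plus \<pi> T \<longrightarrow> r \<noteq> 0 \<longrightarrow> j < n \<longrightarrow>
        N (psi v (n - 1 - j) (D_op v j f) r (r_minus \<pi> T r)) \<le> B"
      and "j \<le> n" "length xs = Suc j" "set xs \<subseteq> R"
    then show "N (PhiL f xs) \<le> B"
      by (intro PhiL_le_digits_bound[OF f n]) auto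
  next
    fix j
    assume "\<forall>j xs. j \<le> n \<longrightarrow> length xs = Suc j \<longrightarrow> set xs \<subseteq> R \<longrightarrow> N (PhiL f xs) \<le> B" "j < n"
    then show "N (D_op v j f 0) \<le> B"
      by (intro norm_digits_le_norm_C_bound(1)[OF f]) auto
  next
    fix r j
    assume "\<forall>j xs. j \<le> n \<longrightarrow> length xs = Suc j \<longrightarrow> set xs \<subseteq> R \<longrightarrow> N (PhiL f xs) \<le> B"
      and "r \<in> R_plus \<pi> T" "r \<noteq> 0" "j < n"
    then show "N (psi v (n - 1 - j) (D_op v j f) r (r_minus \<pi> T r)) \<le> B"
      by (intro norm_digits_le_norm_C_bound(2)[OF f]) auto
  qed
  then show ?thesis
    \<comment> \<open>Extended reals with the same real upper bounds are equal; an infinite supremum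
      is the case without such bounds.\<close>
    by (intro antisym) (rule ereal_le_real; simp)+
qed

end

theorem theorem1p8:
  fixes v :: "'a::{field, metric_space} \<Rightarrow> int"
    and \<pi> :: 'a and T :: "'a set" and n :: nat and f :: "'a \<Rightarrow> 'a"
  assumes "local_field v"
    and "uniformizer v \<pi>"
    and "residue_representatives v T"
    and "n \<ge> 1"
    and "CHAR('a) > 0 \<Longrightarrow> n \<le> CHAR('a) - 1"
    and "f \<in> C_class v n"
  shows "norm_digits v \<pi> T n f = norm_C v n f"
proof -
  interpret digit_system v \<pi> T
    using assms(1-3) by (simp add: digit_system_def digit_system_axioms_def)
  show ?thesis
    using assms by (intro norm_digits_eq_norm_C)
qed

end
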